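(* $\mathsf{UC}_{\mathbb{N}^\mathbb{N}}\equiv_{\mathrm{sW}}\mathsf{CWO}$.
   Context: A represented space is a set $X$ with a partial surjection $\delta_X:\subseteq\mathbb{N}^\mathbb{N}\to X$ (names). A partial $F$ realizes a partial multivalued $f:\subseteq X\rightrightarrows Y$ if for every $x\in\operatorname{dom}(f)$ and name $p$ of $x$, $F(p)$ names an element of $f(x)$. $f\le_{\mathrm{sW}}g$ if there are computable partial $H,K:\subseteq\mathbb{N}^\mathbb{N}\to\mathbb{N}^\mathbb{N}$ such that $p\mapsto K(G(H(p)))$ realizes $f$ for every realizer $G$ of $g$; $\equiv_{\mathrm{sW}}$ is reducibility in both directions. $\mathsf{UC}_{\mathbb{N}^\mathbb{N}}$: given a tree $T\subseteq\mathbb{N}^{<\mathbb{N}}$ (by its characteristic function) whose set of infinite paths is a singleton $\{x\}$, output $x$. $\mathbf{WO}$ is the represented space of well orderings $(X,\preceq_X)$ with domain $X\subseteq\mathbb{N}\setminus\{0\}$, a name being $p\in\mathbb{N}^\mathbb{N}$ with $p(\langle n,m\rangle)=1$ iff $n\preceq_X m$. For $X,Y\in\mathbf{WO}$, $f:\mathbb{N}\to\mathbb{N}$ is a strong comparison map $f:X\le_s Y$ if: $n\notin X\Rightarrow f(n)=0$; for $n,m\in X$, $n\le_X m\leftrightarrow f(n)\le_Y f(m)$; and for $n\in X$, $k\in Y$ with $k\le_Y f(n)$ there is $m\in X$ with $f(m)=k$. $Y+1$ denotes $Y$ with a new largest element added. $\mathsf{CWO}:\mathbf{WO}\times\mathbf{WO}\to\mathbb{N}^\mathbb{N}$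 maps $(X,Y)$ to the unique $f$ such that $f:X\le_s Y$ or $f:Y+1\le_s X$. *)

theory Defs
  imports Main "HOL-Library.Nat_Bijection"
begin

section \<open>Computable partial functions on Baire space\<close>

text \<open>
  Type-2 computability is rendered by the partial recursive functions relative to an oracle:
  a program computes \<open>F(p)\<close> from \<open>p\<close> if, run with oracle \<open>p\<close>, it outputs \<open>F(p)(n)\<close> on
  every input \<open>n\<close>.
\<close>

datatype recf =
    Zero
  | Succ
  | Proj nat
  | Oracle
  | Comp recf "recf list"
  | PrimRec recf recf
  | Mu recf

text \<open>\<open>eval p e xs y\<close>: with oracle \<open>p\<close>, program \<open>e\<close> halts on arguments \<open>xs\<close> with value \<open>y\<close>.\<close>

inductive eval :: "(nat \<Rightarrow> nat) \<Rightarrow> recf \<Rightarrow> nat list \<Rightarrow> nat \<Rightarrow> bool"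
  for p :: "nat \<Rightarrow> nat" where
  Zero: "eval p Zero xs 0"
| Succ: "eval p Succ [x] (Suc x)"
| Proj: "i < length xs \<Longrightarrow> eval p (Proj i) xs (xs ! i)"
| Oracle: "eval p Oracle [x] (p x)"
| Comp: "list_all2 (\<lambda>g y. eval p g xs y) gs ys \<Longrightarrow> eval p f ys z \<Longrightarrow> eval p (Comp f gs) xs z"
| PrimRec_0: "eval p f xs y \<Longrightarrow> eval p (PrimRec f g) (0 # xs) y"
| PrimRec_Suc: "eval p (PrimRec f g) (n # xs) r \<Longrightarrow> eval p g (n # r # xs) y
    \<Longrightarrow> eval p (PrimRec f g) (Suc n # xs) y"
| Mu: "eval p f (n # xs) 0 \<Longrightarrow> (\<forall>m<n. \<exists>k. eval p f (m # xs) (Suc k)) \<Longrightarrow> eval p (Mu f) xs n"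

lemma eval_deterministic:
  assumes "eval p e xs y" "eval p e xs z"
  shows "y = z"
  using assms
proof (induction arbitrary: z rule: eval.induct)
  case (Comp xs gs ys f z')
  from Comp.prems obtain ys' where ys': "list_all2 (\<lambda>g y. eval p g xs y) gs ys'" "eval p f ys' z"
    by (cases) auto
  have "ys = ys'"
    using Comp.IH(1) ys'(1) by (auto simp: list_all2_conv_all_nth intro!: nth_equalityI)
  with ys'(2) Comp.IH(2) show ?case by blast
next
  case (PrimRec_0 f xs y g)
  from PrimRec_0.prems show ?case by (cases) (auto dest: PrimRec_0.IH)
next
  case (PrimRec_Suc f g n xs r y)
  from PrimRec_Suc.prems show ?case by (cases) (auto dest!: PrimRec_Suc.IH)
next
  case (Mu f n xs)
  from Mu.prems have z: "eval p f (z # xs) 0" "\<forall>m<z. \<exists>k. eval p f (m # xs) (Suc k)"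
    by (cases; auto)+
  show ?case
  proof (rule linorder_cases[of n z])
    assume "n < z"
    with z(2) obtain k where "eval p f (n # xs) (Suc k)" by blast
    with Mu.IH(1) show ?thesis by blast
  next
    assume "z < n"
    with Mu.IH(2) z(1) show ?thesis by blast
  qed
qed (auto elim: eval.cases)

text \<open>
  As for type-2 machines, the domain consists of exactly those \<open>p\<close> on which every output digit
  is produced.
\<close>

definition computable :: "((nat \<Rightarrow> nat) \<rightharpoonup> (nat \<Rightarrow> nat)) \<Rightarrow> bool" where
  "computable F \<longleftrightarrow> (\<exists>e. \<forall>p q. F p = Some q \<longleftrightarrow> (\<forall>n. eval p e [n] (q n)))"

section \<open>Represented spaces and strong Weihrauch reducibility\<close>

text \<open>
  A represented space is given by its representation \<open>\<delta>\<close>; the underlying set is \<open>ran \<delta>\<close>, so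
  surjectivity is built in.
\<close>

type_synonym 'a representation = "(nat \<Rightarrow> nat) \<rightharpoonup> 'a"

definition baire_rep :: "(nat \<Rightarrow> nat) representation" where
  "baire_rep = Some"

definition prod_rep :: "'a representation \<Rightarrow> 'b representation \<Rightarrow> ('a \<times> 'b) representation" where
  "prod_rep \<delta> \<delta>' = (\<lambda>p. case (\<delta> (\<lambda>n. p (2 * n)), \<delta>' (\<lambda>n. p (2 * n + 1))) of
     (Some x, Some y) \<Rightarrow> Some (x, y) | _ \<Rightarrow> None)"

text \<open>A problem is a partial multivalued function between represented spaces.\<close>

record ('a, 'b) problem =
  in_rep :: "'a representation"
  out_rep :: "'b representation"
  sols :: "'a \<Rightarrow> 'b set"

definition pdom :: "('a, 'b) problem \<Rightarrow> 'a set" where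
  "pdom f = {x \<in> ran (in_rep f). sols f x \<noteq> {}}"

definition realizes :: "((nat \<Rightarrow> nat) \<rightharpoonup> (nat \<Rightarrow> nat)) \<Rightarrow> ('a, 'b) problem \<Rightarrow> bool" where
  "realizes F f \<longleftrightarrow> (\<forall>x \<in> pdom f. \<forall>p. in_rep f p = Some x \<longrightarrow>
     (\<exists>q y. F p = Some q \<and> out_rep f q = Some y \<and> y \<in> sols f x))"

definition sW_reducible :: "('a, 'b) problem \<Rightarrow> ('c, 'd) problem \<Rightarrow> bool"
    (infix \<open>\<le>\<^sub>s\<^sub>W\<close> 50) where
  "f \<le>\<^sub>s\<^sub>W g \<longleftrightarrow> (\<exists>H K. computable H \<and> computable K \<and>
     (\<forall>G. realizes G g \<longrightarrow> realizes (K \<circ>\<^sub>m G \<circ>\<^sub>m H) f))"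

definition sW_equivalent :: "('a, 'b) problem \<Rightarrow> ('c, 'd) problem \<Rightarrow> bool"
    (infix \<open>\<equiv>\<^sub>s\<^sub>W\<close> 50) where
  "f \<equiv>\<^sub>s\<^sub>W g \<longleftrightarrow> f \<le>\<^sub>s\<^sub>W g \<and> g \<le>\<^sub>s\<^sub>W f"

section \<open>Unique choice on Baire space\<close>

definition is_tree :: "nat list set \<Rightarrow> bool" where
  "is_tree T \<longleftrightarrow> (\<forall>\<sigma> \<tau>. \<sigma> @ \<tau> \<in> T \<longrightarrow> \<sigma> \<in> T)"

definition paths :: "nat list set \<Rightarrow> (nat \<Rightarrow> nat) set" where
  "paths T = {x. \<forall>n. map x [0..<n] \<in> T}"

definition tree_rep :: "nat list set representation" where
  "tree_rep p =
    (if range p \<subseteq> {0, 1} \<and> is_tree {\<sigma>. p (list_encode \<sigma>) = 1}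
     then Some {\<sigma>. p (list_encode \<sigma>) = 1} else None)"

definition UC_Baire :: "(nat list set, nat \<Rightarrow> nat) problem" where
  "UC_Baire = \<lparr>in_rep = tree_rep, out_rep = baire_rep, sols = (\<lambda>T. {x. paths T = {x}})\<rparr>"

section \<open>Comparison of well orderings\<close>

text \<open>
  A well ordering \<open>(X, \<preceq>)\<close> is given by the reflexive relation \<open>\<preceq>\<close>, so that \<open>X\<close> is its field.
  The condition on \<open>p\<close> is that \<open>p\<langle>n,m\<rangle> = 1\<close> iff \<open>n \<preceq> m\<close>; the other values of \<open>p\<close> are arbitrary
  numbers different from 1.
\<close>

definition is_WO :: "nat rel \<Rightarrow> bool" where
  "is_WO r \<longleftrightarrow> Well_order r \<and> 0 \<notin> Field r"

definition WO_rep :: "nat rel representation" where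
  "WO_rep p =
    (if is_WO {(n, m). p (prod_encode (n, m)) = 1}
     then Some {(n, m). p (prod_encode (n, m)) = 1} else None)"

definition strong_comparison_map :: "nat rel \<Rightarrow> nat rel \<Rightarrow> (nat \<Rightarrow> nat) \<Rightarrow> bool" where
  "strong_comparison_map r s f \<longleftrightarrow>
     (\<forall>n. n \<notin> Field r \<longrightarrow> f n = 0) \<and>
     (\<forall>n \<in> Field r. \<forall>m \<in> Field r. (n, m) \<in> r \<longleftrightarrow> (f n, f m) \<in> s) \<and>
     (\<forall>n \<in> Field r. \<forall>k \<in> Field s. (k, f n) \<in> s \<longrightarrow> (\<exists>m \<in> Field r. f m = k))"

text \<open>
  \<open>Y + 1\<close> as a well ordering on positive numbers again: \<open>n \<in> Y\<close> is renamed to \<open>n + 1 \<ge> 2\<close> and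
  the new largest element is \<open>1\<close>.  (\<open>Y\<close> may contain all positive numbers, so some renaming is
  needed.)
\<close>

definition WO_plus_one :: "nat rel \<Rightarrow> nat rel" where
  "WO_plus_one s =
     {(Suc n, Suc m) | n m. (n, m) \<in> s} \<union> {(Suc n, 1) | n. n \<in> Field s} \<union> {(1, 1)}"

definition comparison_map :: "nat rel \<times> nat rel \<Rightarrow> nat \<Rightarrow> nat" where
  "comparison_map = (\<lambda>(r, s).
     THE f. strong_comparison_map r s f \<or> strong_comparison_map (WO_plus_one s) r f)"

definition CWO :: "(nat rel \<times> nat rel, nat \<Rightarrow> nat) problem" where
  "CWO = \<lparr>in_rep = prod_rep WO_rep WO_rep, out_rep = baire_rep,
          sols = (\<lambda>z. {comparison_map z})\<rparr>"

text \<open>The description operator above is well-defined.\<close>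

lemma Field_WO_plus_one: "Field (WO_plus_one s) = insert 1 (Suc ` Field s)"
proof -
  have "WO_plus_one s \<subseteq> insert 1 (Suc ` Field s) \<times> insert 1 (Suc ` Field s)"
    unfolding WO_plus_one_def by (auto intro: FieldI1 FieldI2)
  then have "Field (WO_plus_one s) \<subseteq> insert 1 (Suc ` Field s)"
    unfolding Field_def by blast
  moreover have "(1, 1) \<in> WO_plus_one s" "\<And>n. n \<in> Field s \<Longrightarrow> (Suc n, 1) \<in> WO_plus_one s"
    by (auto simp: WO_plus_one_def)
  then have "insert 1 (Suc ` Field s) \<subseteq> Field (WO_plus_one s)"
    by (blast intro: FieldI1)
  ultimately show ?thesis by blast
qed

lemma is_WO_plus_one:
  assumes "is_WO s"
  shows "is_WO (WO_plus_one s)"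
proof -
  have w: "Well_order s" and z: "0 \<notin> Field s" using assms by (auto simp: is_WO_def)
  have z': "(0, n) \<notin> s" "(n, 0) \<notin> s" for n using z by (auto simp: Field_def)
  have F: "n \<in> Field s \<and> m \<in> Field s" if "(n, m) \<in> s" for n m using that by (auto simp: Field_def)
  have rf: "refl_on (Field s) s" and tr: "trans s" and as: "antisym s"
    and to: "total_on (Field s) s" and wf: "wf (s - Id)"
    using w by (auto simp: order_on_defs)
  have "Refl (WO_plus_one s)"
    using rf unfolding Field_WO_plus_one refl_on_def by (auto simp: WO_plus_one_def)
  moreover have "trans (WO_plus_one s)"
  proof (rule transI)
    fix a b c assume "(a, b) \<in> WO_plus_one s" "(b, c) \<in> WO_plus_one s"
    then show "(a, c) \<in> WO_plus_one s"
      using F z' by (auto simp: WO_plus_one_def dest: transD[OF tr])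
  qed
  moreover have "antisym (WO_plus_one s)"
    using as z z' unfolding antisym_def WO_plus_one_def by auto
  moreover have "Total (WO_plus_one s)"
    using to unfolding Field_WO_plus_one total_on_def by (auto simp: WO_plus_one_def)
  moreover have "wf (WO_plus_one s - Id)"
  proof (rule wfUNIVI)
    fix P x
    assume step: "\<forall>x. (\<forall>y. (y, x) \<in> WO_plus_one s - Id \<longrightarrow> P y) \<longrightarrow> P x"
    have S: "P (Suc n)" if "n \<noteq> 0" for n
      using that
    proof (induction n rule: wf_induct_rule[OF wf])
      case (1 n)
      have "P y" if "(y, Suc n) \<in> WO_plus_one s - Id" for y
        using that 1 z' by (auto simp: WO_plus_one_def)
      then show ?case using step by blast
    qed
    have "P y" if "(y, 1) \<in> WO_plus_one s - Id" for y
      using that S z z' by (force simp: WO_plus_one_def)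
    then have "P 1" using step by blast
    moreover have "P 0" using step by (auto simp: WO_plus_one_def)
    ultimately show "P x" using S by (metis One_nat_def not0_implies_Suc)
  qed
  moreover have "WO_plus_one s \<subseteq> Field (WO_plus_one s) \<times> Field (WO_plus_one s)"
    by (auto simp: Field_def)
  ultimately show ?thesis
    by (auto simp: is_WO_def order_on_defs Field_WO_plus_one)
qed

lemma strong_comparison_map_iff_embed:
  assumes "Well_order r" "Well_order s"
  shows "strong_comparison_map r s f \<longleftrightarrow> embed r s f \<and> (\<forall>n. n \<notin> Field r \<longrightarrow> f n = 0)"
proof
  assume L: "strong_comparison_map r s f"
  have rfr: "\<And>n. n \<in> Field r \<Longrightarrow> (n, n) \<in> r" and rfs: "\<And>n. n \<in> Field s \<Longrightarrow> (n, n) \<in> s"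
    and as: "antisym r" and ts: "trans s"
    using assms by (auto simp: order_on_defs refl_on_def)
  have m: "(n, m) \<in> r \<longleftrightarrow> (f n, f m) \<in> s" if "n \<in> Field r" "m \<in> Field r" for n m
    using L that by (auto simp: strong_comparison_map_def)
  have "compat r s f"
    using m by (auto simp: compat_def Field_def)
  moreover have "inj_on f (Field r)"
    by (rule inj_onI) (metis m rfr as antisymD)
  moreover have "ofilter s (f ` Field r)"
    using L m rfr unfolding ofilter_def under_def strong_comparison_map_def
    by (auto simp: Field_def) blast+
  ultimately show "embed r s f \<and> (\<forall>n. n \<notin> Field r \<longrightarrow> f n = 0)"
    using L embed_iff_compat_inj_on_ofilter[OF assms] by (auto simp: strong_comparison_map_def)
next
  assume R: "embed r s f \<and> (\<forall>n. n \<notin> Field r \<longrightarrow> f n = 0)"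
  then have c: "compat r s f" and i: "inj_on f (Field r)" and o: "ofilter s (f ` Field r)"
    using embed_iff_compat_inj_on_ofilter[OF assms] by auto
  have "(n, m) \<in> r \<longleftrightarrow> (f n, f m) \<in> s" if nm: "n \<in> Field r" "m \<in> Field r" for n m
  proof
    show "(n, m) \<in> r \<Longrightarrow> (f n, f m) \<in> s" using c by (auto simp: compat_def)
  next
    assume fs: "(f n, f m) \<in> s"
    show "(n, m) \<in> r"
    proof (rule ccontr)
      assume no: "(n, m) \<notin> r"
      with assms(1) nm have "n \<noteq> m" by (auto simp: order_on_defs refl_on_def)
      with no assms(1) nm have "(m, n) \<in> r" by (auto simp: order_on_defs total_on_def)
      with c fs assms(2) have "f n = f m" by (auto simp: compat_def order_on_defs antisym_def)
      with i nm \<open>n \<noteq> m\<close> show False by (auto dest: inj_onD)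
    qed
  qed
  with R o show "strong_comparison_map r s f"
    by (auto simp: strong_comparison_map_def ofilter_def under_def) blast
qed

lemma comparison_map_unique_exists:
  assumes "is_WO r" "is_WO s"
  shows "\<exists>!f. strong_comparison_map r s f \<or> strong_comparison_map (WO_plus_one s) r f"
proof -
  let ?s' = "WO_plus_one s"
  have r: "Well_order r" and s: "Well_order s" and s': "Well_order ?s'"
    using assms is_WO_plus_one[OF assms(2)] by (auto simp: is_WO_def)
  have z: "0 \<notin> Field s" using assms by (auto simp: is_WO_def)
  have Suc_s: "(Suc n, Suc m) \<in> ?s' \<longleftrightarrow> (n, m) \<in> s" if "m \<in> Field s" for n m
    using that z by (auto simp: WO_plus_one_def)
  have emb_Suc: "embed s ?s' Suc"
    unfolding embed_iff_compat_inj_on_ofilter[OF s s'] compat_def ofilter_def under_def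
    using z by (auto simp: WO_plus_one_def Field_def)
  have excl: False if "embed r s f" "embed ?s' r g" for f g
  proof -
    have "embed ?s' ?s' (Suc \<circ> (f \<circ> g))"
      using comp_embed[OF comp_embed[OF that(2,1)] emb_Suc] .
    then have "(Suc \<circ> (f \<circ> g)) 1 = id 1"
      using embed_unique[OF s' s' _ id_embed] Field_WO_plus_one by blast
    then have "f (g 1) = 0" by simp
    moreover have "f (g 1) \<in> Field s"
      using embed_Field[OF that(1)] embed_Field[OF that(2)] by (auto simp: Field_WO_plus_one)
    ultimately show False using z by simp
  qed
  have norm: "\<exists>f. strong_comparison_map a b f" if "Well_order a" "Well_order b" "embed a b g" for a b g
  proof -
    let ?h = "\<lambda>n. if n \<in> Field a then g n else 0"
    have "bij_betw ?h (under a n) (under b (?h n))" if n: "n \<in> Field a" for n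
    proof -
      have "?h m = g m" if "m \<in> under a n" for m
        using that by (auto simp: under_def Field_def)
      then have "bij_betw ?h (under a n) (under b (g n)) = bij_betw g (under a n) (under b (g n))"
        by (rule bij_betw_cong)
      with n \<open>embed a b g\<close> show ?thesis by (simp add: embed_def)
    qed
    then have "embed a b ?h" unfolding embed_def by blast
    then show ?thesis using strong_comparison_map_iff_embed[OF that(1,2)] by auto
  qed
  have "(\<exists>f. embed r s f) \<or> (\<exists>g. embed ?s' r g)"
  proof (rule ccontr)
    assume neg: "\<not> ?thesis"
    then obtain f where f: "embed r ?s' f"
      using wellorders_totally_ordered[OF r s'] by blast
    have o: "ofilter ?s' (f ` Field r)" and c: "compat r ?s' f" and i: "inj_on f (Field r)"
      using f embed_iff_compat_inj_on_ofilter[OF r s'] by auto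
    show False
    proof (cases "1 \<in> f ` Field r")
      case True
      have "(n, 1) \<in> ?s'" if "n \<in> Field ?s'" for n
        using that unfolding Field_WO_plus_one by (auto simp: WO_plus_one_def)
      then have "Field ?s' \<le> f ` Field r"
        using o True unfolding ofilter_def under_def by blast
      then show False using inv_into_Field_embed[OF r f] neg by blast
    next
      case False
      then have sub: "f ` Field r \<subseteq> Suc ` Field s"
        using embed_Field[OF f] subset_insert[OF False] unfolding Field_WO_plus_one by metis
      define h where "h = (\<lambda>n. f n - 1)"
      have fh: "f n = Suc (h n) \<and> h n \<in> Field s" if "n \<in> Field r" for n
        using sub that by (auto simp: h_def image_subset_iff)
      have "compat r s h"
        unfolding compat_def
      proof (intro allI impI)
        fix a b assume ab: "(a, b) \<in> r"
        then have "a \<in> Field r" "b \<in> Field r" by (auto simp: Field_def)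
        with ab c fh Suc_s show "(h a, h b) \<in> s" by (metis compat_def)
      qed
      moreover have "inj_on h (Field r)"
        using i fh by (metis inj_on_def)
      moreover have "ofilter s (h ` Field r)"
        unfolding ofilter_def under_def
      proof (intro conjI ballI subsetI)
        fix x assume "x \<in> h ` Field r" then show "x \<in> Field s" using fh by auto
      next
        fix a x assume a: "a \<in> h ` Field r" and x: "x \<in> {b. (b, a) \<in> s}"
        obtain n where n: "n \<in> Field r" "a = h n" using a by auto
        have "(Suc x, f n) \<in> ?s'" using n x fh Suc_s by auto
        then have "Suc x \<in> f ` Field r" using o n by (auto simp: ofilter_def under_def)
        then obtain m where "m \<in> Field r" "f m = Suc x" by auto
        then show "x \<in> h ` Field r" by (auto simp: h_def image_iff intro!: bexI[of _ m])
      qed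
      ultimately show False using neg embed_iff_compat_inj_on_ofilter[OF r s] by blast
    qed
  qed
  then have ex: "\<exists>f. strong_comparison_map r s f \<or> strong_comparison_map ?s' r f"
    using norm[OF r s] norm[OF s' r] by blast
  have uni: "f = g" if "Well_order a" "Well_order b"
    "strong_comparison_map a b f" "strong_comparison_map a b g" for a b f g
  proof
    fix n
    have "embed a b f" "embed a b g" "n \<notin> Field a \<Longrightarrow> f n = 0" "n \<notin> Field a \<Longrightarrow> g n = 0"
      using that(3,4) strong_comparison_map_iff_embed[OF that(1,2)] by auto
    then show "f n = g n"
      using embed_unique[OF that(1,2)] by (cases "n \<in> Field a") auto
  qed
  have "\<not> (strong_comparison_map r s f \<and> strong_comparison_map ?s' r g)" for f g
    using excl strong_comparison_map_iff_embed[OF r s] strong_comparison_map_iff_embed[OF s' r]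
    by blast
  with ex uni[OF r s] uni[OF s' r] show ?thesis by (intro ex_ex1I) blast+
qed

end

(*
  CWO to UC: being the comparison map f is a closed condition on f together with its partial inverse
  and a bit telling which of the two alternatives holds, and these data are unique.

  UC to CWO: let x be the unique path of T. For N = (n,k) consider the pairs of nodes of T of equal
  length, the first passing through k at n and the second avoiding k at n. They form a
  well-founded tree D(N), and so do the nodes of T through k at n paired with descents in D(N)
  extended by a new root. The rank of the latter tree B(N) is at most rank D(N) if x(n) differs from
  k, for then x serves as second component, and it is rank D(N) + 1 if x(n) = k. Repeating every
  child infinitely often lets the Kleene-Brouwer ordering depend on the rank only. Let Y be the
  sum over N of omega copies of V(N), the ordering of D(N) with a new root, and let X be Y with the
  first copy of V(N) replaced by B(N). As B(N) embeds in V(N), strictly monotone maps exist in both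
  directions, so X is compared into Y. The comparison map F lies below every strictly monotone map
  from X to Y, and y lies below F(psi(y)) for every strictly monotone psi from Y to X; hence F sends
  the root of B(N) to the root of the first copy of V(N) iff x(n) = k. Both roots are coded by the
  list [N,0], so x can be read off the fixed points of F.
*)

theory Submission
  imports Defs
begin

section \<open>Closure properties of oracle computable functionals\<close>

text \<open>A program must halt under every oracle, also one that names nothing; closure under
  composition, recursion and case distinction then needs no domain conditions.\<close>

definition recursive :: "((nat \<Rightarrow> nat) \<Rightarrow> nat \<Rightarrow> nat) \<Rightarrow> bool" where
  "recursive F \<longleftrightarrow> (\<exists>e. \<forall>p n. eval p e [n] (F p n))"

definition decidable :: "((nat \<Rightarrow> nat) \<Rightarrow> nat \<Rightarrow> bool) \<Rightarrow> bool" where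
  "decidable P \<longleftrightarrow> recursive (\<lambda>p n. of_bool (P p n))"

named_theorems rec_intros

lemma eval_Comp1: "eval p g xs y \<Longrightarrow> eval p f [y] z \<Longrightarrow> eval p (Comp f [g]) xs z"
  by (rule eval.Comp[where ys = "[y]"]) auto

lemma eval_Comp2:
  "eval p g xs x \<Longrightarrow> eval p h xs y \<Longrightarrow> eval p f [x, y] z \<Longrightarrow> eval p (Comp f [g, h]) xs z"
  by (rule eval.Comp[where ys = "[x, y]"]) auto

lemma eval_Proj_nth: "i < length xs \<Longrightarrow> y = xs ! i \<Longrightarrow> eval p (Proj i) xs y"
  using eval.Proj by blast

lemma recursive_comp1:
  assumes "\<And>p x. eval p e [x] (f p x)" "recursive F"
  shows "recursive (\<lambda>p n. f p (F p n))"
  using assms unfolding recursive_def by (meson eval_Comp1)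

lemma recursive_comp2:
  assumes "\<And>p x y. eval p e [x, y] (f p x y)" "recursive F" "recursive G"
  shows "recursive (\<lambda>p n. f p (F p n) (G p n))"
  using assms unfolding recursive_def by (meson eval_Comp2)

lemma recursive_id [rec_intros]: "recursive (\<lambda>p n. n)"
  unfolding recursive_def by (rule exI[of _ "Proj 0"]) (auto intro: eval_Proj_nth)

lemma recursive_Suc [rec_intros]: "recursive F \<Longrightarrow> recursive (\<lambda>p n. Suc (F p n))"
  by (rule recursive_comp1[OF eval.Succ])

lemma recursive_oracle [rec_intros]: "recursive F \<Longrightarrow> recursive (\<lambda>p n. p (F p n))"
  by (rule recursive_comp1[OF eval.Oracle])

lemma recursive_const [rec_intros]: "recursive (\<lambda>p n. c)"
proof (induction c)
  case 0
  show ?case unfolding recursive_def by (blast intro: eval.Zero)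
qed (rule recursive_Suc)

section \<open>Programs for arithmetic and the Cantor pairing\<close>

definition add_prog :: recf where
  "add_prog = PrimRec (Proj 0) (Comp Succ [Proj 1])"

lemma eval_add_prog: "eval p add_prog [x, y] (x + y)"
  unfolding add_prog_def
  by (induction x)
    (auto intro!: eval.PrimRec_0 eval.PrimRec_Suc eval_Proj_nth eval_Comp1[OF _ eval.Succ])

definition pred_prog :: recf where
  "pred_prog = PrimRec Zero (Proj 0)"

lemma eval_pred_prog: "eval p pred_prog [x] (x - 1)"
  unfolding pred_prog_def
proof (induction x)
  case (Suc x)
  then show ?case by (rule eval.PrimRec_Suc) (auto intro!: eval_Proj_nth)
qed (auto intro!: eval.PrimRec_0 eval.Zero)

text \<open>\<open>PrimRec\<close> recurses on the first argument, so the subtrahend comes first;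
  \<open>recursive_diff\<close> swaps the arguments back.\<close>

definition sub_prog :: recf where
  "sub_prog = PrimRec (Proj 0) (Comp pred_prog [Proj 1])"

lemma eval_sub_prog: "eval p sub_prog [y, x] (x - y)"
  unfolding sub_prog_def
proof (induction y)
  case 0
  show ?case by (auto intro!: eval.PrimRec_0 eval_Proj_nth)
next
  case (Suc y)
  have "eval p (Comp pred_prog [Proj 1]) [y, x - y, x] (x - y - 1)"
    by (rule eval_Comp1[OF _ eval_pred_prog]) (auto intro: eval_Proj_nth)
  with Suc show ?case using eval.PrimRec_Suc by fastforce
qed

definition triangle_prog :: recf where
  "triangle_prog = PrimRec Zero (Comp Succ [Comp add_prog [Proj 0, Proj 1]])"

lemma eval_triangle_prog: "eval p triangle_prog [x] (triangle x)"
  unfolding triangle_prog_def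
proof (induction x)
  case 0
  show ?case by (auto intro: eval.PrimRec_0 eval.Zero)
next
  case (Suc x)
  have "eval p (Comp Succ [Comp add_prog [Proj 0, Proj 1]]) [x, triangle x] (Suc (x + triangle x))"
    by (auto intro!: eval_Comp1[OF _ eval.Succ] eval_Comp2[OF _ _ eval_add_prog] eval_Proj_nth)
  with Suc show ?case using eval.PrimRec_Suc by (fastforce simp: add.commute)
qed

definition pair_prog :: recf where
  "pair_prog = Comp add_prog [Comp triangle_prog [add_prog], Proj 0]"

lemma eval_pair_prog: "eval p pair_prog [x, y] (prod_encode (x, y))"
  unfolding pair_prog_def prod_encode_def
  by (auto intro!: eval_Comp2[OF _ _ eval_add_prog] eval_Comp1[OF eval_add_prog eval_triangle_prog]
      eval_Proj_nth)

lemma eval_Mu: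
  assumes "\<And>i. eval p e (i # xs) (f i)" and "f k = 0" and "\<And>i. i < k \<Longrightarrow> f i \<noteq> 0"
  shows "eval p (Mu e) xs k"
proof (rule eval.Mu)
  show "eval p e (k # xs) 0" using assms(1)[of k] assms(2) by simp
  show "\<forall>i<k. \<exists>j. eval p e (i # xs) (Suc j)"
    using assms(1,3) by (metis not0_implies_Suc)
qed

lemma eval_Mu_Least:
  assumes "\<And>i. eval p e (i # xs) (f i)" and "\<exists>k. f k = 0"
  shows "eval p (Mu e) xs (LEAST k. f k = 0)"
  using assms(1) by (rule eval_Mu) (auto intro: LeastI_ex[OF assms(2)] dest: not_less_Least)

lemma recursive_add [rec_intros]:
  "recursive F \<Longrightarrow> recursive G \<Longrightarrow> recursive (\<lambda>p n. F p n + G p n)"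
  by (rule recursive_comp2[OF eval_add_prog])

lemma recursive_diff [rec_intros]:
  assumes "recursive F" "recursive G"
  shows "recursive (\<lambda>p n. F p n - G p n)"
  using recursive_comp2[OF eval_sub_prog assms(2,1)] .

lemma recursive_triangle: "recursive F \<Longrightarrow> recursive (\<lambda>p n. triangle (F p n))"
  by (rule recursive_comp1[OF eval_triangle_prog])

lemma recursive_prod_encode [rec_intros]:
  "recursive F \<Longrightarrow> recursive G \<Longrightarrow> recursive (\<lambda>p n. prod_encode (F p n, G p n))"
  by (rule recursive_comp2[OF eval_pair_prog])

section \<open>Computing the inverse of the pairing\<close>

definition pfst :: "nat \<Rightarrow> nat" where "pfst z = fst (prod_decode z)"
definition psnd :: "nat \<Rightarrow> nat" where "psnd z = snd (prod_decode z)"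

lemma pfst_prod_encode [simp]: "pfst (prod_encode (a, b)) = a"
  and psnd_prod_encode [simp]: "psnd (prod_encode (a, b)) = b"
  by (simp_all add: pfst_def psnd_def)

lemma prod_encode_pfst_psnd [simp]: "prod_encode (pfst z, psnd z) = z"
  by (simp add: pfst_def psnd_def)

lemma psnd_0 [simp]: "psnd 0 = 0"
  using psnd_prod_encode[of 0 0] by (simp add: prod_encode_def)

lemma triangle_mono: "i \<le> j \<Longrightarrow> triangle i \<le> triangle j"
  by (induction rule: dec_induct) auto

text \<open>Since \<open>prod_encode (a, b) = triangle (a + b) + a\<close>, the index
  \<open>a + b\<close> is the least \<open>s\<close> with \<open>z < triangle (Suc s)\<close>. The
  equation with 0 is the form in which \<open>Mu\<close> can search for it.\<close>

definition diagonal :: "nat \<Rightarrow> nat" where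
  "diagonal z = (LEAST s. Suc z - triangle (Suc s) = 0)"

lemma diagonal_prod_encode: "diagonal (prod_encode (a, b)) = a + b"
  unfolding diagonal_def
proof (rule Least_equality)
  fix s assume "Suc (prod_encode (a, b)) - triangle (Suc s) = 0"
  then have "triangle (a + b) < triangle (Suc s)" by (auto simp: prod_encode_def)
  then show "a + b \<le> s"
    using triangle_mono[of "Suc s" "a + b"] by (meson leD leI Suc_leI)
qed (simp add: prod_encode_def)

lemma recursive_diagonal:
  assumes "recursive F"
  shows "recursive (\<lambda>p n. diagonal (F p n))"
proof (rule recursive_comp1[OF _ assms])
  fix p x
  let ?e = "Comp sub_prog [Comp triangle_prog [Comp Succ [Proj 0]], Comp Succ [Proj 1]]"
  show "eval p (Mu ?e) [x] (diagonal x)"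
    unfolding diagonal_def
  proof (rule eval_Mu_Least)
    show "eval p ?e [i, x] (Suc x - triangle (Suc i))" for i
      by (rule eval_Comp2[OF _ _ eval_sub_prog] eval_Comp1[OF _ eval.Succ] eval_Proj_nth
          eval_Comp1[OF _ eval_triangle_prog] | simp)+
    have "i \<le> triangle i" for i by (induction i) auto
    then show "\<exists>k. Suc x - triangle (Suc k) = 0" by (metis diff_is_0_eq)
  qed
qed

lemma pfst_diagonal: "pfst z = z - triangle (diagonal z)"
  and psnd_diagonal: "psnd z = diagonal z - (z - triangle (diagonal z))"
proof -
  obtain a b where "z = prod_encode (a, b)" using prod_encode_pfst_psnd by metis
  then show "pfst z = z - triangle (diagonal z)"
    "psnd z = diagonal z - (z - triangle (diagonal z))"
    by (simp_all add: diagonal_prod_encode) (simp_all add: prod_encode_def)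
qed

lemma recursive_pfst [rec_intros]: "recursive F \<Longrightarrow> recursive (\<lambda>p n. pfst (F p n))"
  unfolding pfst_diagonal by (intro recursive_diff recursive_triangle recursive_diagonal)

lemma recursive_psnd [rec_intros]: "recursive F \<Longrightarrow> recursive (\<lambda>p n. psnd (F p n))"
  unfolding psnd_diagonal by (intro recursive_diff recursive_triangle recursive_diagonal)

text \<open>
  Functionals of several arguments are treated as unary ones by pairing: in the rules for binders
  the bound variable becomes the first component of the argument.
\<close>

lemma eval_uncurry:
  assumes "recursive (\<lambda>p z. f p (pfst z) (psnd z))"
  shows "\<exists>e. \<forall>p i n. eval p e [i, n] (f p i n)"
proof -
  obtain e where "\<And>p z. eval p e [z] (f p (pfst z) (psnd z))"
    using assms unfolding recursive_def by blast
  then have "eval p (Comp e [pair_prog]) [i, n] (f p i n)" for p i n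
    using eval_Comp1[OF eval_pair_prog] by (metis pfst_prod_encode psnd_prod_encode)
  then show ?thesis by blast
qed

lemma recursive_Least_eq_0:
  assumes "recursive (\<lambda>p z. f p (pfst z) (psnd z))" and "\<And>p n. \<exists>i. f p i n = 0"
  shows "recursive (\<lambda>p n. LEAST i. f p i n = 0)"
proof -
  obtain e where "\<forall>p i n. eval p e [i, n] (f p i n)" using eval_uncurry[OF assms(1)] by blast
  then show ?thesis unfolding recursive_def using eval_Mu_Least assms(2) by meson
qed

lemma recursive_rec_nat [rec_intros]:
  assumes "recursive F" "recursive (\<lambda>p z. G p (pfst z) (pfst (psnd z)) (psnd (psnd z)))" "recursive B"
  shows "recursive (\<lambda>p n. rec_nat (F p n) (\<lambda>i r. G p i r n) (B p n))"
proof -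
  obtain eF where eF: "eval p eF [n] (F p n)" for p n
    using assms(1) unfolding recursive_def by blast
  obtain eG where eG: "eval p eG [z] (G p (pfst z) (pfst (psnd z)) (psnd (psnd z)))" for p z
    using assms(2) unfolding recursive_def by blast
  define g where "g = Comp eG [Comp pair_prog [Proj 0, Comp pair_prog [Proj 1, Proj 2]]]"
  have g: "eval p g [i, r, n] (G p i r n)" for p i r n
  proof -
    have "eval p (Comp pair_prog [Proj 0, Comp pair_prog [Proj 1, Proj 2]]) [i, r, n]
      (prod_encode (i, prod_encode (r, n)))"
      by (auto intro!: eval_Comp2[OF _ _ eval_pair_prog] eval_Proj_nth)
    then show ?thesis unfolding g_def using eval_Comp1 eG
      by (metis pfst_prod_encode psnd_prod_encode)
  qed
  have rec: "eval p (PrimRec eF g) [i, n] (rec_nat (F p n) (\<lambda>i r. G p i r n) i)" for p i n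
    by (induction i) (auto intro: eval.PrimRec_0 eF eval.PrimRec_Suc g)
  show ?thesis
    using recursive_comp2[OF rec assms(3) recursive_id] .
qed

lemma recursive_compose:
  assumes "recursive F" "recursive G"
  shows "recursive (\<lambda>p n. F p (G p n))"
proof -
  obtain e where "\<And>p n. eval p e [n] (F p n)"
    using assms(1) unfolding recursive_def by blast
  then show ?thesis using assms(2) by (rule recursive_comp1)
qed

section \<open>Multiplication, case distinction, decidable predicates and bounded
  quantifiers\<close>

lemma recursive_mult [rec_intros]:
  assumes "recursive F" "recursive G"
  shows "recursive (\<lambda>p n. F p n * G p n)"
proof -
  have "recursive (\<lambda>p n. rec_nat 0 (\<lambda>_ r. r + G p n) (F p n))"
    by (intro rec_intros assms recursive_compose[OF assms(2)])
  moreover have "rec_nat 0 (\<lambda>_ r. r + k) m = m * k" for m k :: nat by (induction m) auto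
  ultimately show ?thesis by simp
qed

lemma recursive_of_bool [rec_intros]:
  "decidable P \<Longrightarrow> recursive (\<lambda>p n. of_bool (P p n))"
  by (simp add: decidable_def)

lemma recursive_if [rec_intros]:
  assumes "decidable P" "recursive F" "recursive G"
  shows "recursive (\<lambda>p n. if P p n then F p n else G p n)"
proof -
  \<comment> \<open>Zero or one round of recursion selects the branch; \<open>G\<close> is evaluated
    in both cases, which is harmless as it is total.\<close>
  have "recursive (\<lambda>p n. rec_nat (G p n) (\<lambda>_ _. F p n) (of_bool (P p n)))"
    by (intro rec_intros assms recursive_compose[OF assms(2)])
  moreover have "rec_nat b (\<lambda>_ _. a) (of_bool c) = (if c then a else b)" for a b :: nat and c
    by simp
  ultimately show ?thesis by simp
qed

lemma decidable_not [rec_intros]: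
  assumes "decidable P"
  shows "decidable (\<lambda>p n. \<not> P p n)"
proof -
  have "recursive (\<lambda>p n. 1 - of_bool (P p n))" by (intro rec_intros assms)
  moreover have "1 - of_bool c = (of_bool (\<not> c) :: nat)" for c by simp
  ultimately show ?thesis by (simp only: decidable_def)
qed

lemma decidable_conj [rec_intros]:
  assumes "decidable P" "decidable Q"
  shows "decidable (\<lambda>p n. P p n \<and> Q p n)"
proof -
  have "recursive (\<lambda>p n. of_bool (P p n) * of_bool (Q p n))" by (intro rec_intros assms)
  then show ?thesis by (simp add: decidable_def of_bool_conj)
qed

lemma decidable_disj [rec_intros]:
  assumes "decidable P" "decidable Q"
  shows "decidable (\<lambda>p n. P p n \<or> Q p n)"
proof -
  have "decidable (\<lambda>p n. \<not> (\<not> P p n \<and> \<not> Q p n))" by (intro rec_intros assms)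
  then show ?thesis by simp
qed

lemma decidable_imp [rec_intros]:
  assumes "decidable P" "decidable Q"
  shows "decidable (\<lambda>p n. P p n \<longrightarrow> Q p n)"
proof -
  have "decidable (\<lambda>p n. \<not> P p n \<or> Q p n)" by (intro rec_intros assms)
  then show ?thesis by (simp only: imp_conv_disj)
qed

lemma decidable_iff [rec_intros]:
  assumes "decidable P" "decidable Q"
  shows "decidable (\<lambda>p n. P p n \<longleftrightarrow> Q p n)"
proof -
  have "decidable (\<lambda>p n. (P p n \<longrightarrow> Q p n) \<and> (Q p n \<longrightarrow> P p n))" by (intro rec_intros assms)
  then show ?thesis by (simp only: iff_conv_conj_imp)
qed

lemma decidable_le [rec_intros]:
  assumes "recursive F" "recursive G"
  shows "decidable (\<lambda>p n. F p n \<le> G p n)"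
proof -
  have "recursive (\<lambda>p n. 1 - (F p n - G p n))" by (intro rec_intros assms)
  moreover have "1 - (a - b) = of_bool (a \<le> b)" for a b :: nat by auto
  ultimately show ?thesis by (simp only: decidable_def)
qed

lemma decidable_less [rec_intros]:
  assumes "recursive F" "recursive G"
  shows "decidable (\<lambda>p n. F p n < G p n)"
proof -
  have "decidable (\<lambda>p n. \<not> G p n \<le> F p n)" by (intro rec_intros assms)
  then show ?thesis by (simp add: not_le)
qed

lemma decidable_eq [rec_intros]:
  assumes "recursive F" "recursive G"
  shows "decidable (\<lambda>p n. F p n = G p n)"
proof -
  have "decidable (\<lambda>p n. F p n \<le> G p n \<and> G p n \<le> F p n)" by (intro rec_intros assms)
  then show ?thesis by (simp add: eq_iff)
qed

lemma decidable_compose: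
  assumes "decidable P" "recursive G"
  shows "decidable (\<lambda>p n. P p (G p n))"
  unfolding decidable_def
  by (rule recursive_compose[OF assms(1)[unfolded decidable_def] assms(2)])

lemma recursive_Least [rec_intros]:
  assumes "decidable (\<lambda>p z. P p (pfst z) (psnd z))" and "\<And>p n. \<exists>i. P p i n"
  shows "recursive (\<lambda>p n. LEAST i. P p i n)"
proof -
  have "recursive (\<lambda>p z. of_bool (\<not> P p (pfst z) (psnd z)))"
    by (intro rec_intros assms(1))
  then have "recursive (\<lambda>p n. LEAST i. of_bool (\<not> P p i n) = (0 :: nat))"
    by (rule recursive_Least_eq_0) (use assms(2) in auto)
  then show ?thesis by simp
qed

lemma decidable_ex_less [rec_intros]:
  assumes "decidable (\<lambda>p z. P p (pfst z) (psnd z))" "recursive B"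
  shows "decidable (\<lambda>p n. \<exists>i<B p n. P p i n)"
proof -
  \<comment> \<open>The recursion below passes \<open>(i, (r, n))\<close>, so the parameter
    \<open>n\<close> sits one pairing deeper, behind the accumulator \<open>r\<close>.\<close>
  have "decidable (\<lambda>p z. P p (pfst z) (psnd (psnd z)))"
    using decidable_compose[OF assms(1), of "\<lambda>p z. prod_encode (pfst z, psnd (psnd z))"]
    by (simp add: rec_intros)
  then have "recursive (\<lambda>p n. rec_nat 0 (\<lambda>i r. if P p i n then 1 else r) (B p n))"
    by (intro rec_intros assms(2))
  moreover have "rec_nat (0 :: nat) (\<lambda>i r. if Q i then 1 else r) b = of_bool (\<exists>i<b. Q i)"
    for Q and b :: nat
    by (induction b) (auto simp: less_Suc_eq)
  ultimately show ?thesis by (simp only: decidable_def)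
qed

lemma decidable_all_less [rec_intros]:
  assumes "decidable (\<lambda>p z. P p (pfst z) (psnd z))" "recursive B"
  shows "decidable (\<lambda>p n. \<forall>i<B p n. P p i n)"
proof -
  have "decidable (\<lambda>p n. \<not> (\<exists>i<B p n. \<not> P p i n))" by (intro rec_intros assms)
  then show ?thesis by simp
qed

section \<open>Computing with codes of lists\<close>

definition code_drop :: "nat \<Rightarrow> nat \<Rightarrow> nat" where
  "code_drop z i = rec_nat z (\<lambda>_ r. psnd (r - 1)) i"

definition code_nth :: "nat \<Rightarrow> nat \<Rightarrow> nat" where
  "code_nth z i = pfst (code_drop z i - 1)"

definition code_length :: "nat \<Rightarrow> nat" where
  "code_length z = (LEAST i. code_drop z i = 0)"

text \<open>A nonempty list has code \<open>Suc (prod_encode (x, list_encode xs))\<close>, so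
  subtracting 1 and taking \<open>psnd\<close> yields the tail. The code 0 of the empty list stays
  fixed by \<open>0 - 1 = 0\<close> and \<open>psnd 0 = 0\<close>.\<close>

lemma code_drop_list_encode [simp]: "code_drop (list_encode xs) i = list_encode (drop i xs)"
proof (induction i)
  case (Suc i)
  have "psnd (list_encode ys - 1) = list_encode (tl ys)" for ys by (cases ys) auto
  then show ?case using Suc by (simp add: code_drop_def tl_drop drop_Suc)
qed (simp add: code_drop_def)

lemma code_nth_list_encode [simp]: "i < length xs \<Longrightarrow> code_nth (list_encode xs) i = xs ! i"
  by (simp add: code_nth_def Cons_nth_drop_Suc[symmetric])

lemma list_encode_eq_0 [simp]: "list_encode xs = 0 \<longleftrightarrow> xs = []"
  by (cases xs) auto

lemma code_length_list_encode [simp]: "code_length (list_encode xs) = length xs"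
  unfolding code_length_def by (rule Least_equality) auto

lemma recursive_code_drop [rec_intros]:
  "recursive F \<Longrightarrow> recursive G \<Longrightarrow> recursive (\<lambda>p n. code_drop (F p n) (G p n))"
  unfolding code_drop_def by (intro rec_intros)

lemma recursive_code_nth [rec_intros]:
  "recursive F \<Longrightarrow> recursive G \<Longrightarrow> recursive (\<lambda>p n. code_nth (F p n) (G p n))"
  unfolding code_nth_def by (intro rec_intros)

lemma recursive_code_length [rec_intros]:
  assumes "recursive F"
  shows "recursive (\<lambda>p n. code_length (F p n))"
proof (rule recursive_compose[OF _ assms])
  \<comment> \<open>Every number codes a list, so the search for the length terminates on all
    inputs.\<close>
  have "\<exists>i. code_drop z i = 0" for z
    using code_drop_list_encode[of "list_decode z" "length (list_decode z)"] by auto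
  then show "recursive (\<lambda>p. code_length)"
    unfolding code_length_def code_drop_def by (intro rec_intros)
qed

lemma recursive_list_encode_map [rec_intros]:
  assumes "recursive (\<lambda>p z. f p (pfst z) (psnd z))" "recursive B"
  shows "recursive (\<lambda>p n. list_encode (map (\<lambda>i. f p i n) [0..<B p n]))"
proof -
  \<comment> \<open>A list code is built from the last entry backwards: round \<open>j\<close>
    prepends the entry with index \<open>B p n - Suc j\<close>, and after \<open>j\<close> rounds
    the last \<open>j\<close> entries are coded.\<close>
  have "recursive (\<lambda>p z. f p (B p (psnd (psnd z)) - Suc (pfst z)) (psnd (psnd z)))"
    using recursive_compose[OF assms(1),
        of "\<lambda>p z. prod_encode (B p (psnd (psnd z)) - Suc (pfst z), psnd (psnd z))"]
    by (simp add: rec_intros recursive_compose[OF assms(2)])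
  then have "recursive (\<lambda>p n. rec_nat 0
      (\<lambda>j r. Suc (prod_encode (f p (B p n - Suc j) n, r))) (B p n))"
    by (intro rec_intros assms(2))
  moreover have *: "rec_nat 0 (\<lambda>j r. Suc (prod_encode (g (b - Suc j), r))) j
      = list_encode (map g [b - j..<b])" if "j \<le> b" for g and b j :: nat
    using that by (induction j) (auto simp: upt_conv_Cons Suc_diff_Suc)
  have "rec_nat 0 (\<lambda>j r. Suc (prod_encode (f p (B p n - Suc j) n, r))) (B p n)
      = list_encode (map (\<lambda>i. f p i n) [0..<B p n])" for p n
    using *[of "B p n" "B p n" "\<lambda>i. f p i n"] by simp
  ultimately show ?thesis by simp
qed

section \<open>Total functionals and unbounded search as computable partial functions\<close>

lemma computable_total:
  assumes "recursive F"
  shows "computable (\<lambda>p. Some (F p))"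
proof -
  obtain e where e: "\<And>p n. eval p e [n] (F p n)" using assms unfolding recursive_def by blast
  then have "Some (F p) = Some q \<longleftrightarrow> (\<forall>n. eval p e [n] (q n))" for p q
    using eval_deterministic by fastforce
  then show ?thesis unfolding computable_def by blast
qed

text \<open>The search diverges at \<open>n\<close> if there is no witness, so its domain is exactly
  the stated one, as \<open>computable\<close> requires. It serves to read a path off a comparison
  map.\<close>

lemma computable_search:
  assumes "decidable (\<lambda>p z. P p (pfst z) (psnd z))"
  shows "computable (\<lambda>p. if \<forall>n. \<exists>k. P p k n then Some (\<lambda>n. LEAST k. P p k n) else None)"
proof -
  have "recursive (\<lambda>p z. of_bool (\<not> P p (pfst z) (psnd z)))" by (intro rec_intros assms)
  from eval_uncurry[OF this] obtain e
    where e: "\<And>p k n. eval p e [k, n] (of_bool (\<not> P p k n))" by auto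
  have 1: "P p k n \<and> (LEAST k. P p k n) = k" if "eval p (Mu e) [n] k" for p n k
    using that
  proof cases
    case Mu
    then have "P p k n" using eval_deterministic[OF e[of p k n]] by (metis of_bool_eq_1_iff zero_neq_one)
    moreover have "\<not> P p m n" if "m < k" for m
      using Mu that eval_deterministic[OF e[of p m n]] by fastforce
    ultimately show ?thesis by (metis LeastI Least_le le_neq_implies_less)
  qed
  have 2: "eval p (Mu e) [n] (LEAST k. P p k n)" if "\<exists>k. P p k n" for p n
    using eval_Mu_Least[OF e, of p n] that by simp
  have "(if \<forall>n. \<exists>k. P p k n then Some (\<lambda>n. LEAST k. P p k n) else None) = Some q
      \<longleftrightarrow> (\<forall>n. eval p (Mu e) [n] (q n))" for p q
  proof (cases "\<forall>n. \<exists>k. P p k n")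
    case True
    then have "eval p (Mu e) [n] k \<longleftrightarrow> (LEAST k. P p k n) = k" for n k
      using 1[of p n k] 2[of p n] by auto
    then show ?thesis using True by (simp add: fun_eq_iff)
  next
    case False
    then show ?thesis using 1 by (simp only: if_False) blast
  qed
  then show ?thesis unfolding computable_def by blast
qed

section \<open>Strictly monotone maps between well orderings\<close>

text \<open>The image need not be an initial segment. Such maps are easy to write down, and they
  bound the comparison map from both sides.\<close>

definition strict_embedding :: "'a rel \<Rightarrow> 'b rel \<Rightarrow> ('a \<Rightarrow> 'b) \<Rightarrow> bool" where
  "strict_embedding r s \<phi> \<longleftrightarrow> (\<forall>a \<in> Field r. \<phi> a \<in> Field s) \<and>
     (\<forall>a b. (a, b) \<in> r - Id \<longrightarrow> (\<phi> a, \<phi> b) \<in> s - Id)"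

lemma strict_embeddingI:
  assumes "\<And>a. a \<in> Field r \<Longrightarrow> \<phi> a \<in> Field s"
    and "\<And>a b. (a, b) \<in> r \<Longrightarrow> a \<noteq> b \<Longrightarrow> (\<phi> a, \<phi> b) \<in> s \<and> \<phi> a \<noteq> \<phi> b"
  shows "strict_embedding r s \<phi>"
  using assms unfolding strict_embedding_def by simp

lemma strict_embedding_Field: "strict_embedding r s \<phi> \<Longrightarrow> a \<in> Field r \<Longrightarrow> \<phi> a \<in> Field s"
  and strict_embedding_less:
    "strict_embedding r s \<phi> \<Longrightarrow> (a, b) \<in> r - Id \<Longrightarrow> (\<phi> a, \<phi> b) \<in> s - Id"
  unfolding strict_embedding_def by blast+

lemma strict_embedding_comp:
  assumes "strict_embedding r s \<phi>" "strict_embedding s t \<psi>"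
  shows "strict_embedding r t (\<psi> \<circ> \<phi>)"
proof (rule strict_embeddingI)
  fix a b assume "(a, b) \<in> r" "a \<noteq> b"
  then have "(\<psi> (\<phi> a), \<psi> (\<phi> b)) \<in> t - Id"
    using strict_embedding_less[OF assms(1)] strict_embedding_less[OF assms(2)] by blast
  then show "((\<psi> \<circ> \<phi>) a, (\<psi> \<circ> \<phi>) b) \<in> t \<and> (\<psi> \<circ> \<phi>) a \<noteq> (\<psi> \<circ> \<phi>) b" by simp
qed (use assms in \<open>simp add: strict_embedding_def\<close>)

lemma Well_order_refl: "Well_order r \<Longrightarrow> a \<in> Field r \<longleftrightarrow> (a, a) \<in> r"
  by (auto simp: order_on_defs refl_on_def intro: FieldI1)

lemma Well_order_cases:
  assumes "Well_order r" "a \<in> Field r" "b \<in> Field r"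
  shows "(a, b) \<in> r \<or> (b, a) \<in> r - Id"
  using assms by (cases "a = b") (auto simp: order_on_defs total_on_def refl_on_def)

lemma Well_order_antisym: "Well_order r \<Longrightarrow> (a, b) \<in> r \<Longrightarrow> (b, a) \<in> r \<Longrightarrow> a = b"
  by (auto simp: order_on_defs antisym_def)

lemma Well_order_induct [consumes 1, case_names less]:
  assumes "Well_order r" "\<And>a. (\<And>b. (b, a) \<in> r - Id \<Longrightarrow> P b) \<Longrightarrow> P a"
  shows "P a"
proof -
  have "wf (r - Id)" using assms(1) by (simp add: well_order_on_def)
  then show ?thesis using assms(2) by (induction a rule: wf_induct_rule) blast
qed

text \<open>By induction along \<open>r\<close>: if \<open>h a\<close> were below \<open>a\<close>,
  then \<open>h (h a)\<close> would be below \<open>h a\<close>, against the induction hypothesis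
  for \<open>h a\<close>.\<close>

lemma strict_embedding_increasing:
  assumes r: "Well_order r" and h: "strict_embedding r r h"
  shows "a \<in> Field r \<Longrightarrow> (a, h a) \<in> r"
  using r
proof (induction a rule: Well_order_induct)
  case (less a)
  have ha: "h a \<in> Field r" using strict_embedding_Field[OF h less.prems] .
  show ?case
  proof (rule ccontr)
    assume "(a, h a) \<notin> r"
    with Well_order_cases[OF r less.prems ha] have *: "(h a, a) \<in> r - Id" by blast
    then have "(h (h a), h a) \<in> r - Id" by (rule strict_embedding_less[OF h])
    moreover have "(h a, h (h a)) \<in> r" using less.IH[OF *] ha by blast
    ultimately show False using Well_order_antisym[OF r] by blast
  qed
qed

section \<open>Strong comparison maps against strictly monotone maps\<close>

lemma strong_comparison_map_iff:
  assumes "strong_comparison_map r s F" "a \<in> Field r" "b \<in> Field r"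
  shows "(a, b) \<in> r \<longleftrightarrow> (F a, F b) \<in> s"
  using assms by (auto simp: strong_comparison_map_def)

lemma strong_comparison_map_initial:
  assumes "strong_comparison_map r s F" "a \<in> Field r" "(c, F a) \<in> s"
  shows "\<exists>b\<in>Field r. F b = c"
proof -
  have "\<forall>n \<in> Field r. \<forall>k \<in> Field s. (k, F n) \<in> s \<longrightarrow> (\<exists>m \<in> Field r. F m = k)"
    using assms(1) unfolding strong_comparison_map_def by (elim conjE)
  then show ?thesis using assms(2,3) FieldI1 by fastforce
qed

lemma strong_comparison_map_Field:
  assumes "Well_order r" "strong_comparison_map r s F" "a \<in> Field r"
  shows "F a \<in> Field s"
  using strong_comparison_map_iff[OF assms(2,3,3)] assms(1,3) Well_order_refl
  by (metis FieldI1)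

lemma strong_comparison_map_inj:
  assumes "Well_order r" "Well_order s" "strong_comparison_map r s F"
    "a \<in> Field r" "b \<in> Field r" "F a = F b"
  shows "a = b"
  using strong_comparison_map_iff[OF assms(3)] strong_comparison_map_Field[OF assms(1,3)]
    assms(4-6) Well_order_refl[OF assms(2)] Well_order_antisym[OF assms(1)]
  by metis

lemma strong_comparison_map_strict_embedding:
  assumes "Well_order r" "Well_order s" "strong_comparison_map r s F"
  shows "strict_embedding r s F"
proof (rule strict_embeddingI)
  fix a b assume ab: "(a, b) \<in> r" "a \<noteq> b"
  then have "a \<in> Field r" "b \<in> Field r" by (auto intro: FieldI1 FieldI2)
  with ab show "(F a, F b) \<in> s \<and> F a \<noteq> F b"
    using strong_comparison_map_inj[OF assms] strong_comparison_map_iff[OF assms(3)] by blast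
qed (rule strong_comparison_map_Field[OF assms(1,3)])

text \<open>If \<open>\<phi> a\<close> were below \<open>F a\<close>, it would be \<open>F m\<close>
  for some \<open>m\<close> below \<open>a\<close>, as the image of \<open>F\<close> is an initial
  segment; but then \<open>F m \<le> \<phi> m < \<phi> a = F m\<close>.\<close>

lemma strong_comparison_map_le:
  assumes r: "Well_order r" and s: "Well_order s"
    and F: "strong_comparison_map r s F" and \<phi>: "strict_embedding r s \<phi>"
  shows "a \<in> Field r \<Longrightarrow> (F a, \<phi> a) \<in> s"
  using r
proof (induction a rule: Well_order_induct)
  case (less a)
  have \<phi>a: "\<phi> a \<in> Field s" using strict_embedding_Field[OF \<phi> less.prems] .
  have Fa: "F a \<in> Field s" using strong_comparison_map_Field[OF r F] less.prems .
  show ?case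
  proof (rule ccontr)
    assume "(F a, \<phi> a) \<notin> s"
    with Well_order_cases[OF s Fa \<phi>a] have *: "(\<phi> a, F a) \<in> s - Id" by blast
    then obtain m where m: "m \<in> Field r" "F m = \<phi> a"
      using strong_comparison_map_initial[OF F less.prems] by blast
    with * have "(m, a) \<in> r - Id" using strong_comparison_map_iff[OF F m(1) less.prems] by auto
    then have "(F m, \<phi> m) \<in> s" "(\<phi> m, \<phi> a) \<in> s - Id"
      using less.IH m(1) strict_embedding_less[OF \<phi>] by blast+
    then show False using m(2) Well_order_antisym[OF s] by auto
  qed
qed

text \<open>\<open>F \<circ> \<psi>\<close> is a strictly monotone self-map of \<open>s\<close> and
  so nowhere falls below the identity.\<close>

lemma strong_comparison_map_ge:
  assumes "Well_order r" "Well_order s" "strong_comparison_map r s F"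
    "strict_embedding s r \<psi>" "b \<in> Field s"
  shows "(b, F (\<psi> b)) \<in> s"
  using strict_embedding_increasing[OF assms(2), of "F \<circ> \<psi>"] assms
    strict_embedding_comp strong_comparison_map_strict_embedding
  by (metis comp_apply)

text \<open>\<open>\<phi> \<circ> F\<close> would map \<open>Y + 1\<close> strictly into
  \<open>Y\<close>. Restricted to \<open>Y\<close> it is a strictly monotone self-map that sends the
  image \<open>t\<close> of the top strictly below \<open>t\<close>, which
  \<open>strict_embedding_increasing\<close> excludes.\<close>

lemma not_strong_comparison_map_plus_one:
  assumes r: "is_WO r" and s: "is_WO s" and \<phi>: "strict_embedding r s \<phi>"
  shows "\<not> strong_comparison_map (WO_plus_one s) r F"
proof
  let ?s' = "WO_plus_one s"
  assume F: "strong_comparison_map ?s' r F"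
  have wo: "Well_order r" "Well_order s" "Well_order ?s'"
    using r s is_WO_plus_one[OF s] by (auto simp: is_WO_def)
  have F\<phi>: "strict_embedding ?s' s (\<phi> \<circ> F)"
    by (rule strict_embedding_comp[OF strong_comparison_map_strict_embedding[OF wo(3,1) F] \<phi>])
  have "strict_embedding s ?s' Suc"
    by (rule strict_embeddingI) (auto simp: Field_WO_plus_one, auto simp: WO_plus_one_def)
  from strict_embedding_comp[OF this F\<phi>] have h: "strict_embedding s s (\<phi> \<circ> F \<circ> Suc)"
    by (simp add: comp_assoc)
  define t where "t = \<phi> (F 1)"
  have t: "t \<in> Field s"
    using strict_embedding_Field[OF F\<phi>, of 1] by (simp add: Field_WO_plus_one t_def)
  \<comment> \<open>\<open>Suc t\<close> is the copy of \<open>t\<close> in \<open>Y + 1\<close>. It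
    differs from the top 1 because 0 is not in \<open>Field s\<close>.\<close>
  then have "(Suc t, 1) \<in> ?s' - Id" using s by (cases "t = 0") (auto simp: WO_plus_one_def is_WO_def)
  then have "(\<phi> (F (Suc t)), t) \<in> s - Id"
    using strict_embedding_less[OF F\<phi>] unfolding t_def comp_apply by blast
  moreover have "(t, \<phi> (F (Suc t))) \<in> s"
    using strict_embedding_increasing[OF wo(2) h t] by simp
  ultimately show False using Well_order_antisym[OF wo(2)] by blast
qed

section \<open>Comparison of well orderings reduces to unique choice\<close>

text \<open>
  To turn the comparison map \<open>f\<close> into the unique solution of a closed condition it is paired with
  a partial inverse \<open>g\<close>, where \<open>g k = m + 1\<close> if \<open>f m = k\<close> and \<open>g k = 0\<close> if \<open>k\<close> is not a value.
  Below, \<open>a\<close>, \<open>b\<close>, \<open>c\<close> stand for \<open>f i\<close>, \<open>f j\<close>, \<open>g j\<close>.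
\<close>

definition comparison_constraint ::
    "nat rel \<Rightarrow> nat rel \<Rightarrow> nat \<Rightarrow> nat \<Rightarrow> nat \<Rightarrow> nat \<Rightarrow> nat \<Rightarrow> bool" where
  "comparison_constraint r s i j a b c \<longleftrightarrow>
     ((i, i) \<notin> r \<longrightarrow> a = 0) \<and>
     ((i, i) \<in> r \<and> (j, j) \<in> r \<longrightarrow> ((i, j) \<in> r \<longleftrightarrow> (a, b) \<in> s)) \<and>
     ((i, i) \<in> r \<and> (j, a) \<in> s \<longrightarrow> c \<noteq> 0) \<and>
     (c = Suc i \<longleftrightarrow> (i, i) \<in> r \<and> a = j)"

text \<open>The third clause gives every \<open>k\<close> below a value of \<open>f\<close> a
  nonzero \<open>g k\<close>, and the last clause turns this into a preimage. Thus the existential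
  condition on the image is expressed through finitely many values at a time.\<close>

lemma comparison_constraint_strong_comparison_map:
  assumes "Well_order r" and *: "\<And>i j. comparison_constraint r s i j (f i) (f j) (g j)"
  shows "strong_comparison_map r s f"
  unfolding strong_comparison_map_def
proof (intro conjI ballI allI impI)
  note R = Well_order_refl[OF assms(1)]
  show "n \<notin> Field r \<Longrightarrow> f n = 0" for n
    using *[of n n] by (auto simp: comparison_constraint_def R)
  show "n \<in> Field r \<Longrightarrow> m \<in> Field r \<Longrightarrow> (n, m) \<in> r \<longleftrightarrow> (f n, f m) \<in> s" for n m
    using *[of n m] by (auto simp: comparison_constraint_def R)
  fix n k assume "n \<in> Field r" "(k, f n) \<in> s"
  then have "g k \<noteq> 0" using *[of n k] by (auto simp: comparison_constraint_def R)
  then obtain m where "g k = Suc m" using not0_implies_Suc by blast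
  then have "m \<in> Field r \<and> f m = k" using *[of m k] by (auto simp: comparison_constraint_def R)
  then show "\<exists>m\<in>Field r. f m = k" by blast
qed

lemma strong_comparison_map_constraint:
  assumes r: "Well_order r" and s: "Well_order s" and f: "strong_comparison_map r s f"
  shows "\<exists>g. \<forall>i j. comparison_constraint r s i j (f i) (f j) (g j)"
proof -
  define g where
    "g k = (if \<exists>m\<in>Field r. f m = k then Suc (THE m. m \<in> Field r \<and> f m = k) else 0)" for k
  have g: "g j = Suc i \<longleftrightarrow> i \<in> Field r \<and> f i = j" for i j
  proof (cases "\<exists>m\<in>Field r. f m = j")
    case True
    then have "\<exists>!m. m \<in> Field r \<and> f m = j"
      using strong_comparison_map_inj[OF r s f] by auto
    from theI'[OF this] this show ?thesis using True by (auto simp: g_def)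
  qed (auto simp: g_def)
  have "g j \<noteq> 0" if "i \<in> Field r" "(j, f i) \<in> s" for i j
  proof -
    from strong_comparison_map_initial[OF f that] obtain m where "m \<in> Field r \<and> f m = j"
      by blast
    then have "g j = Suc m" using g by blast
    then show ?thesis by simp
  qed
  moreover have "n \<notin> Field r \<Longrightarrow> f n = 0" for n
    using f by (simp add: strong_comparison_map_def)
  ultimately have "comparison_constraint r s i j (f i) (f j) (g j)" for i j
    unfolding comparison_constraint_def Well_order_refl[OF r, symmetric]
    using g strong_comparison_map_iff[OF f, of i j] by blast
  then show ?thesis by blast
qed

text \<open>The last clause fixes every nonzero value of the inverse in terms of \<open>f\<close>,
  and hence also where it is 0.\<close>

lemma comparison_constraint_unique:
  assumes "\<And>i j. comparison_constraint r s i j (f i) (f j) (g j)"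
    and "\<And>i j. comparison_constraint r s i j (f i) (f j) (h j)"
  shows "g = h"
proof
  fix j
  have "g j = Suc i \<longleftrightarrow> h j = Suc i" for i
    using assms unfolding comparison_constraint_def by blast
  then show "g j = h j" by (metis not0_implies_Suc)
qed

text \<open>
  In \<open>WO_plus_one\<close> the field of \<open>s\<close> occurs, which is not decidable in \<open>s\<close> unless \<open>s\<close> is reflexive.
\<close>

definition plus_one_rel :: "nat rel \<Rightarrow> nat rel" where
  "plus_one_rel s = {(a, b). a \<noteq> 0 \<and> b \<noteq> 0 \<and>
     ((a - 1, b - 1) \<in> s \<or> b = 1 \<and> (a = 1 \<or> (a - 1, a - 1) \<in> s))}"

lemma plus_one_rel:
  assumes "is_WO s"
  shows "plus_one_rel s = WO_plus_one s"
proof -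
  have "n \<in> Field s \<longleftrightarrow> (n, n) \<in> s" for n
    by (rule Well_order_refl) (use assms in \<open>simp add: is_WO_def\<close>)
  then have "(a, b) \<in> plus_one_rel s \<longleftrightarrow> (a, b) \<in> WO_plus_one s" for a b
    by (cases a; cases b) (auto simp: WO_plus_one_def plus_one_rel_def)
  then show ?thesis by auto
qed

text \<open>An entry codes \<open>(b, (f n, g n))\<close>, where the bit \<open>b\<close> is 0 for
  the alternative from \<open>X\<close> to \<open>Y\<close> and 1 for the one from
  \<open>Y + 1\<close> to \<open>X\<close>. It is repeated in every entry, so that any two positions
  can be checked on their own.\<close>

definition comparison_path_constraint :: "nat rel \<Rightarrow> nat rel \<Rightarrow> nat \<Rightarrow> nat \<Rightarrow> nat \<Rightarrow> nat \<Rightarrow> bool" where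
  "comparison_path_constraint r s i j u v \<longleftrightarrow>
     pfst u = pfst v \<and> pfst u \<le> 1 \<and>
     (pfst u = 0 \<longrightarrow> comparison_constraint r s i j
        (pfst (psnd u)) (pfst (psnd v)) (psnd (psnd v))) \<and>
     (pfst u = 1 \<longrightarrow> comparison_constraint (plus_one_rel s) r i j
        (pfst (psnd u)) (pfst (psnd v)) (psnd (psnd v)))"

definition comparison_tree :: "nat rel \<Rightarrow> nat rel \<Rightarrow> nat list set" where
  "comparison_tree r s =
     {\<sigma>. \<forall>i<length \<sigma>. \<forall>j<length \<sigma>. comparison_path_constraint r s i j (\<sigma> ! i) (\<sigma> ! j)}"

lemma is_tree_comparison_tree: "is_tree (comparison_tree r s)"
  unfolding is_tree_def comparison_tree_def
  by (auto simp: nth_append split: if_splits)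

lemma paths_comparison_tree_iff:
  "x \<in> paths (comparison_tree r s) \<longleftrightarrow> (\<forall>i j. comparison_path_constraint r s i j (x i) (x j))"
proof
  assume x: "x \<in> paths (comparison_tree r s)"
  show "\<forall>i j. comparison_path_constraint r s i j (x i) (x j)"
  proof (intro allI)
    fix i j
    have "map x [0..<Suc (i + j)] \<in> comparison_tree r s"
      using x unfolding paths_def by blast
    then have "\<forall>k<Suc (i + j). \<forall>l<Suc (i + j). comparison_path_constraint r s k l (x k) (x l)"
      by (simp add: comparison_tree_def del: upt_Suc)
    then show "comparison_path_constraint r s i j (x i) (x j)" by simp
  qed
qed (simp add: paths_def comparison_tree_def)

text \<open>The comparison map and its partial inverse give a path. It is the only one: the two
  alternatives exclude each other, which fixes the bit, then \<open>f\<close> is unique, and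
  \<open>f\<close> determines \<open>g\<close>.\<close>

lemma paths_comparison_tree:
  assumes r: "is_WO r" and s: "is_WO s"
  obtains x where "paths (comparison_tree r s) = {x}"
    "(\<lambda>n. pfst (psnd (x n))) = comparison_map (r, s)"
proof -
  let ?s' = "WO_plus_one s" and ?f = "comparison_map (r, s)"
  let ?A = "\<lambda>f. strong_comparison_map r s f" and ?B = "\<lambda>f. strong_comparison_map ?s' r f"
  have wo: "Well_order r" "Well_order s" "Well_order ?s'"
    using r s is_WO_plus_one[OF s] by (auto simp: is_WO_def)
  have ex1: "\<exists>!f. ?A f \<or> ?B f" using comparison_map_unique_exists[OF r s] .
  from theI'[OF this] have f: "?A ?f \<or> ?B ?f"
    by (simp add: comparison_map_def)
  have excl: "\<not> (?A h \<and> ?B h')" for h h'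
    using not_strong_comparison_map_plus_one[OF r s]
      strong_comparison_map_strict_embedding[OF wo(1,2)] by blast
  define b :: nat where "b = (if ?A ?f then 0 else 1)"
  obtain g where g: "if b = 0 then \<forall>i j. comparison_constraint r s i j (?f i) (?f j) (g j)
      else \<forall>i j. comparison_constraint ?s' r i j (?f i) (?f j) (g j)"
    using f strong_comparison_map_constraint[OF wo(1,2)] strong_comparison_map_constraint[OF wo(3,1)]
    unfolding b_def by fastforce
  define x where "x n = prod_encode (b, prod_encode (?f n, g n))" for n
  have "x \<in> paths (comparison_tree r s)"
    using g by (auto simp: paths_comparison_tree_iff comparison_path_constraint_def x_def b_def
        plus_one_rel[OF s] split: if_splits)
  moreover have "y = x" if "y \<in> paths (comparison_tree r s)" for y
  proof -
    define c where "c = pfst (y 0)"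
    define f' where "f' n = pfst (psnd (y n))" for n
    define g' where "g' n = psnd (psnd (y n))" for n
    have y: "comparison_path_constraint r s i j (y i) (y j)" for i j
      using that by (simp add: paths_comparison_tree_iff)
    have c: "pfst (y n) = c" "c \<le> 1" for n
      using y[of 0 n] by (auto simp: comparison_path_constraint_def c_def)
    have g': "if c = 0 then \<forall>i j. comparison_constraint r s i j (f' i) (f' j) (g' j)
      else \<forall>i j. comparison_constraint ?s' r i j (f' i) (f' j) (g' j)"
      using y c by (auto simp: comparison_path_constraint_def f'_def g'_def plus_one_rel[OF s])
    then have "if c = 0 then ?A f' else ?B f'"
      using comparison_constraint_strong_comparison_map wo(1,3) by (metis (full_types))
    then have ff: "f' = ?f" and "c = b"
      using ex1 f excl c(2) by (auto simp: b_def split: if_splits)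
    with g g' have "g' = g"
      using comparison_constraint_unique[of r s ?f g' g]
        comparison_constraint_unique[of ?s' r ?f g' g] by (auto split: if_splits)
    show "y = x"
    proof
      fix n
      have "y n = prod_encode (pfst (y n), prod_encode (pfst (psnd (y n)), psnd (psnd (y n))))"
        by simp
      also have "\<dots> = x n"
        using c(1)[of n] \<open>c = b\<close> ff \<open>g' = g\<close> by (auto simp: x_def f'_def g'_def fun_eq_iff)
      finally show "y n = x n" .
    qed
  qed
  ultimately have "paths (comparison_tree r s) = {x}" by blast
  moreover have "(\<lambda>n. pfst (psnd (x n))) = ?f" by (simp add: x_def)
  ultimately show thesis using that by blast
qed

section \<open>Names of pairs of well orderings, and the first reduction\<close>

definition oracle_rel :: "(nat \<Rightarrow> nat) \<Rightarrow> nat rel" where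
  "oracle_rel p = {(n, m). p (prod_encode (n, m)) = 1}"

definition left_rel :: "(nat \<Rightarrow> nat) \<Rightarrow> nat rel" where
  "left_rel p = oracle_rel (\<lambda>n. p (2 * n))"

definition right_rel :: "(nat \<Rightarrow> nat) \<Rightarrow> nat rel" where
  "right_rel p = oracle_rel (\<lambda>n. p (2 * n + 1))"

lemma in_rep_CWO:
  "in_rep CWO p = Some z \<longleftrightarrow>
     is_WO (left_rel p) \<and> is_WO (right_rel p) \<and> z = (left_rel p, right_rel p)"
  by (auto simp: CWO_def prod_rep_def WO_rep_def left_rel_def right_rel_def oracle_rel_def
      split: option.splits if_splits)

lemma decidable_left_rel [rec_intros]:
  assumes "recursive F" "recursive G"
  shows "decidable (\<lambda>p n. (F p n, G p n) \<in> left_rel p)"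
  by (simp add: left_rel_def oracle_rel_def) (intro rec_intros assms)

lemma decidable_right_rel [rec_intros]:
  assumes "recursive F" "recursive G"
  shows "decidable (\<lambda>p n. (F p n, G p n) \<in> right_rel p)"
  by (simp add: right_rel_def oracle_rel_def) (intro rec_intros assms)

lemma decidable_plus_one_rel [rec_intros]:
  assumes "recursive F" "recursive G"
  shows "decidable (\<lambda>p n. (F p n, G p n) \<in> plus_one_rel (right_rel p))"
  unfolding plus_one_rel_def mem_Collect_eq prod.case by (intro rec_intros assms)

lemma decidable_comparison_tree:
  "decidable (\<lambda>p z. list_decode z \<in> comparison_tree (left_rel p) (right_rel p))"
proof -
  have "decidable (\<lambda>p z. \<forall>i<code_length z. \<forall>j<code_length z.
      comparison_path_constraint (left_rel p) (right_rel p) i j (code_nth z i) (code_nth z j))"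
    unfolding comparison_path_constraint_def comparison_constraint_def by (intro rec_intros)
  moreover have "(\<forall>i<code_length z. \<forall>j<code_length z.
      comparison_path_constraint r s i j (code_nth z i) (code_nth z j))
    \<longleftrightarrow> list_decode z \<in> comparison_tree r s" for z r s
    using code_nth_list_encode[of _ "list_decode z"] code_length_list_encode[of "list_decode z"]
    by (simp add: comparison_tree_def)
  ultimately show ?thesis by simp
qed

text \<open>\<open>K\<close> sees only the path, as strong reducibility demands; the comparison map
  is stored in its entries.\<close>

lemma CWO_le_UC_Baire: "CWO \<le>\<^sub>s\<^sub>W UC_Baire"
proof -
  let ?T = "\<lambda>p. comparison_tree (left_rel p) (right_rel p)"
  define H :: "(nat \<Rightarrow> nat) \<rightharpoonup> (nat \<Rightarrow> nat)"
    where "H p = Some (\<lambda>z. of_bool (list_decode z \<in> ?T p))" for p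
  define K :: "(nat \<Rightarrow> nat) \<rightharpoonup> (nat \<Rightarrow> nat)"
    where "K q = Some (\<lambda>n. pfst (psnd (q n)))" for q
  have "computable H" "computable K"
    unfolding H_def K_def
    by (intro computable_total rec_intros decidable_comparison_tree)+
  moreover have "realizes (K \<circ>\<^sub>m G \<circ>\<^sub>m H) CWO" if G: "realizes G UC_Baire" for G
    unfolding realizes_def
  proof (intro ballI allI impI)
    fix z p assume "in_rep CWO p = Some z"
    then have wo: "is_WO (left_rel p)" "is_WO (right_rel p)" and z: "z = (left_rel p, right_rel p)"
      by (simp_all add: in_rep_CWO)
    obtain x where x: "paths (?T p) = {x}" "(\<lambda>n. pfst (psnd (x n))) = comparison_map z"
      using paths_comparison_tree[OF wo] z by blast
    define q :: "nat \<Rightarrow> nat" where "q z = of_bool (list_decode z \<in> ?T p)" for z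
    have q: "H p = Some q" "\<And>\<sigma>. q (list_encode \<sigma>) = 1 \<longleftrightarrow> \<sigma> \<in> ?T p" "range q \<subseteq> {0, 1}"
      by (auto simp: H_def q_def fun_eq_iff)
    have name: "in_rep UC_Baire q = Some (?T p)"
      using q(2,3) is_tree_comparison_tree by (simp add: UC_Baire_def tree_rep_def)
    have sols: "sols UC_Baire (?T p) = {x}" using x(1) by (auto simp: UC_Baire_def)
    have "?T p \<in> ran (in_rep UC_Baire)" using name unfolding ran_def by blast
    with sols have "?T p \<in> pdom UC_Baire" by (simp add: pdom_def)
    with G name obtain q' y where "G q = Some q'" "out_rep UC_Baire q' = Some y" "y \<in> {x}"
      unfolding realizes_def sols[symmetric] by blast
    then have "G q = Some x" by (simp add: UC_Baire_def baire_rep_def)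
    then have "(K \<circ>\<^sub>m G \<circ>\<^sub>m H) p = Some (comparison_map z)"
      using x by (simp add: map_comp_def q(1) K_def)
    then show "\<exists>q y. (K \<circ>\<^sub>m G \<circ>\<^sub>m H) p = Some q \<and> out_rep CWO q = Some y \<and> y \<in> sols CWO z"
      by (simp add: CWO_def baire_rep_def)
  qed
  ultimately show ?thesis unfolding sW_reducible_def by blast
qed

section \<open>The Kleene-Brouwer ordering\<close>

fun kb_less :: "nat list \<Rightarrow> nat list \<Rightarrow> bool" where
  "kb_less [] ys \<longleftrightarrow> False"
| "kb_less (x # xs) [] \<longleftrightarrow> True"
| "kb_less (x # xs) (y # ys) \<longleftrightarrow> x < y \<or> x = y \<and> kb_less xs ys"

lemma kb_less_irrefl [simp]: "\<not> kb_less xs xs"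
  by (induction xs) auto

lemma kb_less_trans: "kb_less xs ys \<Longrightarrow> kb_less ys zs \<Longrightarrow> kb_less xs zs"
proof (induction xs zs arbitrary: ys rule: kb_less.induct)
  case (3 x xs z zs)
  then show ?case by (cases ys) auto
qed auto

lemma kb_less_linear: "kb_less xs ys \<or> xs = ys \<or> kb_less ys xs"
  by (induction xs ys rule: kb_less.induct) (auto elim: kb_less.elims(3))

text \<open>Bounded quantifiers make the order decidable on codes; \<open>i = length ys\<close> is
  the case of a proper extension.\<close>

lemma kb_less_iff_nth:
  "kb_less xs ys \<longleftrightarrow> (\<exists>i<Suc (length ys). i < length xs \<and> (\<forall>j<i. xs ! j = ys ! j) \<and>
     (i = length ys \<or> xs ! i < ys ! i))"
  by (induction xs ys rule: kb_less.induct)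
    (simp_all add: Ex_less_Suc2 All_less_Suc2 del: ex_simps, blast)

text \<open>Let \<open>j\<close> be the least first entry in a set without minimum. A predecessor of
  a string beginning with \<open>j\<close> again begins with \<open>j\<close>, so the tails of these
  strings form another nonempty set without minimum. Iterating this collects the entries of
  \<open>z\<close>.\<close>

lemma kb_less_minimal:
  assumes "S \<noteq> {}" and min: "\<And>\<sigma>. \<sigma> \<in> S \<Longrightarrow> \<exists>\<tau>\<in>S. kb_less \<tau> \<sigma>"
  shows "\<exists>z. \<forall>m. \<exists>\<tau>. map z [0..<m] @ \<tau> \<in> S"
proof -
  define bad where "bad A \<longleftrightarrow> A \<noteq> {} \<and> (\<forall>\<sigma>\<in>A. \<exists>\<tau>\<in>A. kb_less \<tau> \<sigma>)" for A
  have step: "\<exists>j. bad {\<tau>. j # \<tau> \<in> A}" if "bad A" for A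
  proof -
    define j where "j = (LEAST j. \<exists>\<tau>. j # \<tau> \<in> A)"
    \<comment> \<open>A predecessor of any string is nonempty.\<close>
    have "\<exists>j \<tau>. j # \<tau> \<in> A"
      using that unfolding bad_def by (metis equals0I kb_less.simps(1) list.exhaust)
    then have j: "\<exists>\<tau>. j # \<tau> \<in> A" unfolding j_def by (rule LeastI_ex)
    have jmin: "j \<le> i" if "i # \<tau> \<in> A" for i \<tau>
      unfolding j_def using that by (intro Least_le) blast
    have "\<exists>\<tau>. j # \<tau> \<in> A \<and> kb_less \<tau> \<sigma>" if \<sigma>: "j # \<sigma> \<in> A" for \<sigma>
    proof -
      obtain \<rho> where \<rho>: "\<rho> \<in> A" "kb_less \<rho> (j # \<sigma>)"
        using \<open>bad A\<close> \<sigma> unfolding bad_def by blast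
      obtain i \<tau> where "\<rho> = i # \<tau>" using \<rho>(2) by (cases \<rho>) auto
      with \<rho> jmin[of i \<tau>] show ?thesis by auto
    qed
    with j have "bad {\<tau>. j # \<tau> \<in> A}" by (simp add: bad_def)
    then show ?thesis by blast
  qed
  define next_entry where "next_entry A = (SOME j. bad {\<tau>. j # \<tau> \<in> A})" for A
  define B where "B = rec_nat S (\<lambda>_ A. {\<tau>. next_entry A # \<tau> \<in> A})"
  define z where "z m = next_entry (B m)" for m
  have B: "bad (B m) \<and> B m = {\<tau>. map z [0..<m] @ \<tau> \<in> S}" for m
  proof (induction m)
    case 0
    show ?case using assms by (simp add: B_def bad_def)
  next
    case (Suc m)
    have "B (Suc m) = {\<tau>. z m # \<tau> \<in> B m}" by (simp add: B_def z_def)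
    moreover have "bad {\<tau>. z m # \<tau> \<in> B m}"
      unfolding z_def next_entry_def by (rule someI_ex, rule step) (use Suc in blast)
    ultimately show ?case using Suc by simp
  qed
  have "\<exists>\<tau>. map z [0..<m] @ \<tau> \<in> S" for m
    using B[of m] unfolding bad_def by blast
  then show ?thesis by blast
qed

section \<open>Kleene-Brouwer orderings as elements of WO\<close>

definition kb_rel :: "nat list set \<Rightarrow> nat rel" where
  "kb_rel S = {(a, b). list_decode a \<in> S \<and> list_decode b \<in> S \<and>
     (a = b \<or> kb_less (list_decode a) (list_decode b))}"

lemma Field_kb_rel: "Field (kb_rel S) = {a. list_decode a \<in> S}"
proof -
  have "(a, a) \<in> kb_rel S" if "list_decode a \<in> S" for a using that by (simp add: kb_rel_def)
  then show ?thesis by (auto simp: Field_def kb_rel_def)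
qed

text \<open>A set of codes without minimum would, by \<open>kb_less_minimal\<close>, give a branch
  all of whose prefixes extend into \<open>S\<close>, which \<open>branch\<close> forbids. The empty
  string is left out since its code is 0.\<close>

lemma is_WO_kb_rel:
  assumes "[] \<notin> S" and branch: "\<And>z. \<exists>m. \<forall>\<tau>. map z [0..<m] @ \<tau> \<notin> S"
  shows "is_WO (kb_rel S)"
proof -
  let ?r = "kb_rel S"
  have "Refl ?r" unfolding refl_on_def Field_kb_rel by (auto simp: kb_rel_def)
  moreover have "trans ?r"
    unfolding trans_def kb_rel_def by (auto dest: kb_less_trans)
  moreover have "antisym ?r"
    unfolding antisym_def kb_rel_def using kb_less_trans kb_less_irrefl by blast
  moreover have "Total ?r"
    unfolding total_on_def Field_kb_rel using kb_less_linear
    by (auto simp: kb_rel_def) (metis list_decode_eq)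
  moreover have "wf (?r - Id)"
  proof (rule wfI_min)
    fix a and Q :: "nat set" assume a: "a \<in> Q"
    show "\<exists>c\<in>Q. \<forall>b. (b, c) \<in> ?r - Id \<longrightarrow> b \<notin> Q"
    proof (rule ccontr)
      assume neg: "\<not> ?thesis"
      define A where "A = {\<sigma> \<in> S. list_encode \<sigma> \<in> Q}"
      have *: "\<exists>b\<in>Q. list_decode b \<in> A \<and> list_decode c \<in> A \<and> kb_less (list_decode b) (list_decode c)"
        if "c \<in> Q" for c
        using neg that by (fastforce simp: kb_rel_def A_def)
      have "A \<noteq> {}" using *[OF a] by blast
      moreover have "\<exists>\<tau>\<in>A. kb_less \<tau> \<sigma>" if "\<sigma> \<in> A" for \<sigma>
        using *[of "list_encode \<sigma>"] that by (auto simp: A_def)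
      ultimately obtain z where "\<And>m. \<exists>\<tau>. map z [0..<m] @ \<tau> \<in> A"
        using kb_less_minimal by blast
      then show False using branch[of z] by (auto simp: A_def)
    qed
  qed
  moreover have "?r \<subseteq> Field ?r \<times> Field ?r" by (auto simp: Field_def)
  moreover have "0 \<notin> Field ?r" using assms(1) by (simp add: Field_kb_rel)
  ultimately show ?thesis by (auto simp: is_WO_def order_on_defs)
qed

lemma strict_embedding_kb_rel:
  assumes "\<And>\<sigma>. \<sigma> \<in> S \<Longrightarrow> h \<sigma> \<in> S'"
    and "\<And>\<sigma> \<tau>. \<sigma> \<in> S \<Longrightarrow> \<tau> \<in> S \<Longrightarrow> kb_less \<sigma> \<tau> \<Longrightarrow> kb_less (h \<sigma>) (h \<tau>)"
  shows "strict_embedding (kb_rel S) (kb_rel S') (\<lambda>a. list_encode (h (list_decode a)))"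
proof (rule strict_embeddingI)
  fix a b assume "(a, b) \<in> kb_rel S" "a \<noteq> b"
  then have *: "list_decode a \<in> S" "list_decode b \<in> S" "kb_less (list_decode a) (list_decode b)"
    by (auto simp: kb_rel_def)
  then have "kb_less (h (list_decode a)) (h (list_decode b))" by (rule assms(2))
  with * show "(list_encode (h (list_decode a)), list_encode (h (list_decode b))) \<in> kb_rel S' \<and>
    list_encode (h (list_decode a)) \<noteq> list_encode (h (list_decode b))"
    using assms(1) by (auto simp: kb_rel_def list_encode_eq)
qed (use assms(1) in \<open>simp add: Field_kb_rel\<close>)

section \<open>Relabelling strings position by position\<close>

fun map_pos :: "(nat \<Rightarrow> 'a \<Rightarrow> 'b) \<Rightarrow> 'a list \<Rightarrow> 'b list" where
  "map_pos g [] = []"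
| "map_pos g (e # v) = g 0 e # map_pos (\<lambda>i. g (Suc i)) v"

lemma length_map_pos [simp]: "length (map_pos g v) = length v"
  by (induction v arbitrary: g) auto

lemma nth_map_pos [simp]: "i < length v \<Longrightarrow> map_pos g v ! i = g i (v ! i)"
  by (induction v arbitrary: g i) (auto simp: nth_Cons split: nat.split)

text \<open>Strictly increasing relabellings keep the lengths, the place of the first difference and
  its direction.\<close>

lemma kb_less_map_pos:
  assumes "\<And>i. strict_mono (g i)"
  shows "kb_less xs ys \<Longrightarrow> kb_less (map_pos g xs) (map_pos g ys)"
  using assms
  by (induction xs ys arbitrary: g rule: kb_less.induct) (auto simp: strict_mono_less)

section \<open>Unique choice reduces to comparison of well orderings\<close>

text \<open>
  An entry \<open>e\<close> carries three numbers, and every triple is carried by infinitely many entries, so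
  that any labelling of the entries is realized by a strictly increasing relabelling.
\<close>

definition pa :: "nat \<Rightarrow> nat" where "pa e = pfst (pfst e)"
definition pb :: "nat \<Rightarrow> nat" where "pb e = pfst (psnd (pfst e))"
definition pc :: "nat \<Rightarrow> nat" where "pc e = psnd (psnd (pfst e))"

lemma strict_mono_relabelling:
  fixes a b c :: "nat \<Rightarrow> nat \<Rightarrow> nat"
  obtains g where "\<And>i. strict_mono (g i)"
    and "\<And>i e. pa (g i e) = a i e" "\<And>i e. pb (g i e) = b i e" "\<And>i e. pc (g i e) = c i e"
proof -
  define F where "F i e = prod_encode (a i e, prod_encode (b i e, c i e))" for i e
  have "\<exists>h. \<forall>e. pfst (h e) = F i e \<and> h e < h (Suc e)" for i
  proof (rule dependent_nat_choice)
    show "\<exists>y. pfst y = F i 0" by (metis pfst_prod_encode)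
    \<comment> \<open>The second component of an entry can be chosen freely, and a pair code is at
      least its second component; so \<open>Suc y\<close> there lifts the entry above
      \<open>y\<close>.\<close>
    show "\<exists>y'. pfst y' = F i (Suc e) \<and> y < y'" for y e
      by (rule exI[of _ "prod_encode (F i (Suc e), Suc y)"])
        (use le_prod_encode_2[of "Suc y"] in \<open>simp add: Suc_le_eq\<close>)
  qed
  then obtain g where "\<And>i e. pfst (g i e) = F i e" "\<And>i e. g i e < g i (Suc e)" by metis
  then show thesis
    using that[of g] by (simp add: pa_def pb_def pc_def F_def strict_mono_Suc_iff)
qed

text \<open>This is the tree D(N), with \<open>N\<close> coding \<open>(n, k)\<close> and both nodes
  carried by the entries of one string. The component \<open>pa\<close> is reserved for
  \<open>through\<close>.\<close>

definition two_branches :: "nat list set \<Rightarrow> nat \<Rightarrow> nat list \<Rightarrow> bool" where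
  "two_branches T N w \<longleftrightarrow> map pb w \<in> T \<and> map pc w \<in> T \<and>
     (pfst N < length w \<longrightarrow> pb (w ! pfst N) = psnd N \<and> pc (w ! pfst N) \<noteq> psnd N)"

definition through :: "nat list set \<Rightarrow> nat \<Rightarrow> nat list \<Rightarrow> bool" where
  "through T N v \<longleftrightarrow> map pa v \<in> T \<and> (pfst N < length v \<longrightarrow> pa (v ! pfst N) = psnd N)"

text \<open>The first entry of \<open>v\<close> is skipped by \<open>tl\<close>: this adds a new root to the tree.\<close>

definition target :: "nat list set \<Rightarrow> nat list set" where
  "target T = {N # i # v | N i v. two_branches T N (tl v)}"

text \<open>Only copy 0 is restricted, to B(N). There \<open>pa\<close> traces a node along all of
  \<open>v\<close>, while \<open>pb\<close> and \<open>pc\<close> trace theirs along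
  \<open>tl v\<close>, one entry behind.\<close>

definition source :: "nat list set \<Rightarrow> nat list set" where
  "source T = {N # i # v | N i v. two_branches T N (tl v) \<and> (i = 0 \<longrightarrow> through T N v)}"

lemma source_subset_target: "source T \<subseteq> target T"
  by (auto simp: source_def target_def)

section \<open>Correctness for a tree with a unique path\<close>

context
  fixes T :: "nat list set" and x :: "nat \<Rightarrow> nat"
  assumes tree: "is_tree T" and path: "paths T = {x}"
begin

lemma path_in_tree: "map x [0..<m] \<in> T"
  using path by (auto simp: paths_def)

lemma path_eqI: "(\<And>m. map y [0..<m] \<in> T) \<Longrightarrow> y = x"
  using path by (auto simp: paths_def)

lemma Nil_in_tree: "[] \<in> T"
  using path_in_tree[of 0] by simp

text \<open>An infinite branch would yield two paths of \<open>T\<close>, one with value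
  \<open>k\<close> at \<open>n\<close> and one with another value.\<close>

lemma target_branch: "\<exists>m. \<forall>\<tau>. map z [0..<m] @ \<tau> \<notin> target T"
proof (rule ccontr)
  assume neg: "\<not> ?thesis"
  define N where "N = z 0"
  \<comment> \<open>Three entries are dropped: \<open>N\<close>, the copy number, and the entry
    skipped by \<open>tl\<close>.\<close>
  define y where "y = (\<lambda>i. z (Suc (Suc (Suc i))))"
  have y: "map (\<lambda>i. pb (y i)) [0..<m] \<in> T \<and> map (\<lambda>i. pc (y i)) [0..<m] \<in> T \<and>
    (pfst N < m \<longrightarrow> pb (y (pfst N)) = psnd N \<and> pc (y (pfst N)) \<noteq> psnd N)" for m
  proof -
    obtain \<tau> where "map z [0..<Suc (Suc (Suc m))] @ \<tau> \<in> target T" using neg by blast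
    then have "N # z 1 # z 2 # map y [0..<m] @ \<tau> \<in> target T"
      by (simp add: map_upt_Suc N_def y_def numeral_2_eq_2 del: upt_Suc)
    then have "two_branches T N (map y [0..<m] @ \<tau>)" by (simp add: target_def)
    moreover have "map f [0..<m] \<in> T" if "map f [0..<m] @ \<rho> \<in> T" for f \<rho>
      using tree that unfolding is_tree_def by blast
    ultimately show ?thesis by (auto simp: two_branches_def nth_append comp_def)
  qed
  have "(\<lambda>i. pb (y i)) = x" "(\<lambda>i. pc (y i)) = x" using y by (auto intro!: path_eqI)
  then have "pb (y i) = pc (y i)" for i by (metis (full_types))
  then show False using y[of "Suc (pfst N)"] by simp
qed

lemma is_WO_target: "is_WO (kb_rel (target T))"
  using target_branch by (intro is_WO_kb_rel) (auto simp: target_def)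

lemma is_WO_source: "is_WO (kb_rel (source T))"
proof (rule is_WO_kb_rel)
  show "\<exists>m. \<forall>\<tau>. map z [0..<m] @ \<tau> \<notin> source T" for z
    using target_branch[of z] source_subset_target by blast
qed (simp add: source_def)

lemma inclusion: "strict_embedding (kb_rel (source T)) (kb_rel (target T)) id"
  using strict_embedding_kb_rel[of "source T" id "target T"] source_subset_target
  by (auto simp: id_def)

text \<open>\<open>inclusion\<close> rules out the alternative from \<open>Y + 1\<close> to
  \<open>X\<close>.\<close>

lemma comparison_source_target:
  "strong_comparison_map (kb_rel (source T)) (kb_rel (target T))
     (comparison_map (kb_rel (source T), kb_rel (target T)))"
  using theI'[OF comparison_map_unique_exists[OF is_WO_source is_WO_target]]
    not_strong_comparison_map_plus_one[OF is_WO_source is_WO_target inclusion]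
  by (auto simp: comparison_map_def)

lemma marker_in_source: "[N, 0] \<in> source T"
  by (simp add: source_def two_branches_def through_def Nil_in_tree)

text \<open>As \<open>x\<close> passes through \<open>k\<close> at \<open>n\<close>, it can serve as
  the \<open>pa\<close> component of every string, so the first copy of V(N) embeds into B(N) with
  root going to root.\<close>

lemma embedding_fixing_marker:
  assumes N: "x (pfst N) = psnd N"
  shows "\<exists>\<psi>. strict_embedding (kb_rel (target T)) (kb_rel (source T)) \<psi> \<and>
    \<psi> (list_encode [N, 0]) = list_encode [N, 0]"
proof -
  obtain g where g: "\<And>i. strict_mono (g i)"
    "\<And>i e. pa (g i e) = x i" "\<And>i e. pb (g i e) = pb e" "\<And>i e. pc (g i e) = pc e"
    using strict_mono_relabelling[of "\<lambda>i e. x i" "\<lambda>i. pb" "\<lambda>i. pc"] by blast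
  \<comment> \<open>For \<open>M \<noteq> N\<close> each copy moves to the next one, away from the
    restricted copy 0; for \<open>N\<close> itself only copy 0 is relabelled.\<close>
  define h where "h \<sigma> = (case \<sigma> of M # i # v \<Rightarrow>
      M # (if M \<noteq> N then Suc i # v else if i = 0 then 0 # map_pos g v else i # v) | _ \<Rightarrow> \<sigma>)" for \<sigma>
  have "map pa (map_pos g v) = map x [0..<length v]" for v
    by (rule nth_equalityI) (simp_all add: g)
  then have through: "through T N (map_pos g v)" for v
    using N by (simp add: through_def path_in_tree g)
  have "map pb (tl (map_pos g v)) = map pb (tl v)" "map pc (tl (map_pos g v)) = map pc (tl v)" for v
    by (rule nth_equalityI; simp add: g nth_tl)+
  then have "two_branches T N (tl (map_pos g v)) \<longleftrightarrow> two_branches T N (tl v)" for v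
    unfolding two_branches_def by (auto simp: nth_tl g)
  with through have "h \<sigma> \<in> source T" if "\<sigma> \<in> target T" for \<sigma>
    using that by (auto simp: target_def source_def h_def)
  moreover have "kb_less (h \<sigma>) (h \<tau>)" if "\<sigma> \<in> target T" "\<tau> \<in> target T" "kb_less \<sigma> \<tau>" for \<sigma> \<tau>
    using that kb_less_map_pos[OF g(1)] by (auto simp: target_def h_def)
  ultimately have "strict_embedding (kb_rel (target T)) (kb_rel (source T))
      (\<lambda>a. list_encode (h (list_decode a)))"
    by (rule strict_embedding_kb_rel)
  then show ?thesis by (intro exI conjI) (assumption, simp only: list_encode_inverse, simp add: h_def)
qed

text \<open>A node through \<open>k\<close> at \<open>n\<close> together with \<open>x\<close>,
  which avoids \<open>k\<close> there, satisfies \<open>two_branches\<close>. Moving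
  \<open>pa\<close> to \<open>pb\<close> and writing \<open>x\<close> into \<open>pc\<close> thus
  embeds B(N) into D(N), strictly below the root of V(N).\<close>

lemma embedding_lowering_marker:
  assumes N: "x (pfst N) \<noteq> psnd N"
  shows "\<exists>\<phi>. strict_embedding (kb_rel (source T)) (kb_rel (target T)) \<phi> \<and>
    \<phi> (list_encode [N, 0]) = list_encode [N, 0, 0]"
proof -
  obtain g where g: "\<And>i. strict_mono (g i)"
    "\<And>i e. pa (g i e) = 0" "\<And>i e. pb (g i e) = pa e" "\<And>i e. pc (g i e) = x i"
    using strict_mono_relabelling[of "\<lambda>i e. 0" "\<lambda>i. pa" "\<lambda>i e. x i"] by blast
  \<comment> \<open>The inserted 0 is the entry that \<open>tl\<close> skips; it puts the image of
    the root one level below \<open>[N, 0]\<close>.\<close>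
  define h where "h \<sigma> = (case \<sigma> of M # i # v \<Rightarrow>
      M # i # (if M = N \<and> i = 0 then 0 # map_pos g v else v) | _ \<Rightarrow> \<sigma>)" for \<sigma>
  have "map pb (map_pos g v) = map pa v" "map pc (map_pos g v) = map x [0..<length v]" for v
    by (rule nth_equalityI; simp add: g)+
  then have "two_branches T N (map_pos g v)" if "through T N v" for v
    using N that by (simp add: two_branches_def through_def path_in_tree g)
  then have "h \<sigma> \<in> target T" if "\<sigma> \<in> source T" for \<sigma>
    using that by (auto simp: target_def source_def h_def)
  moreover have "kb_less (h \<sigma>) (h \<tau>)" if "\<sigma> \<in> source T" "\<tau> \<in> source T" "kb_less \<sigma> \<tau>" for \<sigma> \<tau>
    using that kb_less_map_pos[OF g(1)] by (auto simp: source_def h_def)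
  ultimately have "strict_embedding (kb_rel (source T)) (kb_rel (target T))
      (\<lambda>a. list_encode (h (list_decode a)))"
    by (rule strict_embedding_kb_rel)
  then show ?thesis by (intro exI conjI) (assumption, simp only: list_encode_inverse, simp add: h_def)
qed

text \<open>If \<open>x\<close> passes through \<open>k\<close> at \<open>n\<close>, the value at
  the marker is bounded above by \<open>inclusion\<close> and below by the embedding
  \<open>\<psi>\<close>, which both fix the marker. Otherwise it is at most
  \<open>[N, 0, 0]\<close>, strictly below the marker.\<close>

lemma comparison_map_marker:
  "comparison_map (kb_rel (source T), kb_rel (target T)) (list_encode [N, 0]) = list_encode [N, 0]
     \<longleftrightarrow> x (pfst N) = psnd N"
proof -
  let ?r = "kb_rel (source T)" and ?s = "kb_rel (target T)"
  let ?F = "comparison_map (?r, ?s)" and ?c = "list_encode [N, 0]"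
  note F = comparison_source_target
  have wo: "Well_order ?r" "Well_order ?s"
    using is_WO_source is_WO_target by (simp_all add: is_WO_def)
  have r: "?c \<in> Field ?r" and s: "?c \<in> Field ?s"
    unfolding Field_kb_rel mem_Collect_eq list_encode_inverse
    using marker_in_source source_subset_target by blast+
  show ?thesis
  proof (cases "x (pfst N) = psnd N")
    case True
    then obtain \<psi> where \<psi>: "strict_embedding ?s ?r \<psi>" "\<psi> ?c = ?c"
      using embedding_fixing_marker by blast
    have "(?F ?c, ?c) \<in> ?s" using strong_comparison_map_le[OF wo F inclusion r] by (simp only: id_apply)
    moreover have "(?c, ?F ?c) \<in> ?s" using strong_comparison_map_ge[OF wo F \<psi>(1) s] by (simp only: \<psi>(2))
    ultimately show ?thesis using True Well_order_antisym[OF wo(2)] by blast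
  next
    case False
    then obtain \<phi> where \<phi>: "strict_embedding ?r ?s \<phi>" "\<phi> ?c = list_encode [N, 0, 0]"
      using embedding_lowering_marker by blast
    have "(?F ?c, list_encode [N, 0, 0]) \<in> ?s"
      using strong_comparison_map_le[OF wo F \<phi>(1) r] by (simp only: \<phi>(2))
    moreover have "(list_encode [N, 0], list_encode [N, 0, 0]) \<notin> ?s"
      unfolding kb_rel_def mem_Collect_eq prod.case list_encode_inverse list_encode_eq by simp
    ultimately show ?thesis using False by metis
  qed
qed

end

section \<open>Deciding the two orderings from the tree, and the second reduction\<close>

definition oracle_tree :: "(nat \<Rightarrow> nat) \<Rightarrow> nat list set" where
  "oracle_tree p = {\<sigma>. p (list_encode \<sigma>) = 1}"

lemma decidable_kb_less [rec_intros]: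
  assumes "recursive F" "recursive G"
  shows "decidable (\<lambda>p n. kb_less (list_decode (F p n)) (list_decode (G p n)))"
proof -
  define P where "P a b \<longleftrightarrow> (\<exists>i<Suc (code_length b). i < code_length a \<and>
      (\<forall>j<i. code_nth a j = code_nth b j) \<and>
      (i = code_length b \<or> code_nth a i < code_nth b i))" for a b
  have "decidable (\<lambda>p z. P (pfst z) (psnd z))"
    unfolding P_def by (intro rec_intros)
  from decidable_compose[OF this recursive_prod_encode[OF assms]]
  have "decidable (\<lambda>p n. P (F p n) (G p n))" by simp
  moreover have "P (list_encode \<sigma>) (list_encode \<tau>) \<longleftrightarrow> kb_less \<sigma> \<tau>" for \<sigma> \<tau>
    unfolding P_def kb_less_iff_nth code_length_list_encode
    by (intro ex_cong1 conj_cong refl) (auto simp: less_Suc_eq)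
  then have "P a b \<longleftrightarrow> kb_less (list_decode a) (list_decode b)" for a b
    by (metis list_decode_inverse)
  ultimately show ?thesis by simp
qed

lemma list_encode_map_code_nth:
  assumes "map f (drop k \<sigma>) = \<tau>"
  shows "list_encode (map (\<lambda>i. f (code_nth (list_encode \<sigma>) (i + k))) [0..<length \<sigma> - k])
    = list_encode \<tau>"
proof -
  have "map (\<lambda>i. f (code_nth (list_encode \<sigma>) (i + k))) [0..<length \<sigma> - k] = \<tau>"
    unfolding assms[symmetric] by (rule nth_equalityI) (auto simp: add.commute)
  then show ?thesis by simp
qed

text \<open>In the code of \<open>N # i # v\<close> the entries of \<open>tl v\<close> start at
  position 3. Truncated subtraction gives the right length 0 when \<open>v\<close> is empty.\<close>

definition code_two_branches :: "(nat \<Rightarrow> nat) \<Rightarrow> nat \<Rightarrow> bool" where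
  "code_two_branches p a \<longleftrightarrow>
     p (list_encode (map (\<lambda>i. pb (code_nth a (i + 3))) [0..<code_length a - 3])) = 1 \<and>
     p (list_encode (map (\<lambda>i. pc (code_nth a (i + 3))) [0..<code_length a - 3])) = 1 \<and>
     (pfst (code_nth a 0) < code_length a - 3 \<longrightarrow>
        pb (code_nth a (pfst (code_nth a 0) + 3)) = psnd (code_nth a 0) \<and>
        pc (code_nth a (pfst (code_nth a 0) + 3)) \<noteq> psnd (code_nth a 0))"

definition code_through :: "(nat \<Rightarrow> nat) \<Rightarrow> nat \<Rightarrow> bool" where
  "code_through p a \<longleftrightarrow>
     p (list_encode (map (\<lambda>i. pa (code_nth a (i + 2))) [0..<code_length a - 2])) = 1 \<and>
     (pfst (code_nth a 0) < code_length a - 2 \<longrightarrow>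
        pa (code_nth a (pfst (code_nth a 0) + 2)) = psnd (code_nth a 0))"

lemma code_two_branches_iff:
  "code_two_branches p (list_encode (N # i # v)) \<longleftrightarrow> two_branches (oracle_tree p) N (tl v)"
proof -
  have nth: "j < length v - 1 \<Longrightarrow> code_nth (list_encode (N # i # v)) (j + 3) = tl v ! j" for j
    by (simp del: list_encode.simps add: nth_tl numeral_3_eq_3)
  have "map f (drop 3 (N # i # v)) = map f (tl v)" for f :: "nat \<Rightarrow> nat"
    by (simp add: numeral_3_eq_3 drop_Suc)
  from list_encode_map_code_nth[OF this]
  show ?thesis
    unfolding code_two_branches_def two_branches_def oracle_tree_def code_length_list_encode
    using nth[of "pfst N"] by (simp del: list_encode.simps)
qed

lemma code_through_iff:
  "code_through p (list_encode (N # i # v)) \<longleftrightarrow> through (oracle_tree p) N v"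
proof -
  have nth: "j < length v \<Longrightarrow> code_nth (list_encode (N # i # v)) (j + 2) = v ! j" for j
    by (simp del: list_encode.simps)
  have "map f (drop 2 (N # i # v)) = map f v" for f :: "nat \<Rightarrow> nat" by simp
  from list_encode_map_code_nth[OF this]
  show ?thesis
    unfolding code_through_def through_def oracle_tree_def code_length_list_encode
    using nth[of "pfst N"] by (simp del: list_encode.simps)
qed

lemma target_iff_code:
  "list_decode a \<in> target (oracle_tree p) \<longleftrightarrow> 2 \<le> code_length a \<and> code_two_branches p a"
    (is ?target)
  and source_iff_code:
  "list_decode a \<in> source (oracle_tree p) \<longleftrightarrow>
     2 \<le> code_length a \<and> code_two_branches p a \<and> (code_nth a 1 = 0 \<longrightarrow> code_through p a)"
    (is ?source)
proof -
  define \<sigma> where "\<sigma> = list_decode a"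
  have a: "a = list_encode \<sigma>" by (simp add: \<sigma>_def)
  have *: "?target \<and> ?source"
  proof (cases "2 \<le> length \<sigma>")
    case True
    then obtain N i v where \<sigma>: "\<sigma> = N # i # v"
      by (metis Suc_le_length_iff numeral_2_eq_2)
    have "code_nth a 1 = i" unfolding a by (simp add: \<sigma> del: list_encode.simps)
    moreover have "code_length a = Suc (Suc (length v))"
      unfolding a by (simp add: \<sigma> del: list_encode.simps)
    moreover have "list_decode a = N # i # v" by (simp add: \<sigma>[symmetric] \<sigma>_def)
    ultimately show ?thesis
      by (simp add: a \<sigma> target_def source_def code_two_branches_iff code_through_iff
          del: list_encode.simps)
  next
    case False
    then show ?thesis by (auto simp: a target_def source_def)
  qed
  show ?target using * by (rule conjunct1)
  show ?source using * by (rule conjunct2)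
qed

lemma decidable_target:
  "decidable (\<lambda>p z. list_decode z \<in> target (oracle_tree p))"
  and decidable_source:
  "decidable (\<lambda>p z. list_decode z \<in> source (oracle_tree p))"
  unfolding target_iff_code source_iff_code code_two_branches_def code_through_def
    pa_def pb_def pc_def
  by (intro rec_intros)+

lemma decidable_kb_rel:
  assumes "decidable (\<lambda>p z. list_decode z \<in> S p)" "recursive F" "recursive G"
  shows "decidable (\<lambda>p n. (F p n, G p n) \<in> kb_rel (S p))"
  unfolding kb_rel_def mem_Collect_eq prod.case
  by (intro rec_intros assms decidable_compose[OF assms(1)])

text \<open>This is \<open>n div 2\<close>, written as a search that always terminates.\<close>

definition half :: "nat \<Rightarrow> nat" where
  "half n = (LEAST h. n \<le> 2 * h + 1)"

lemma half_simps [simp]: "half (2 * n) = n" "half (2 * n + 1) = n"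
  unfolding half_def by (rule Least_equality; simp)+

lemma recursive_half [rec_intros]:
  assumes "recursive F"
  shows "recursive (\<lambda>p n. half (F p n))"
proof (rule recursive_compose[OF _ assms])
  show "recursive (\<lambda>p. half)"
    unfolding half_def by (intro rec_intros) presburger
qed

text \<open>The two orderings are interleaved as \<open>prod_rep\<close> expects.\<close>

definition comparison_instance :: "(nat \<Rightarrow> nat) \<Rightarrow> nat \<Rightarrow> nat" where
  "comparison_instance p n = of_bool
     (if n = 2 * half n
      then (pfst (half n), psnd (half n)) \<in> kb_rel (source (oracle_tree p))
      else (pfst (half n), psnd (half n)) \<in> kb_rel (target (oracle_tree p)))"

lemma recursive_comparison_instance: "recursive comparison_instance"
proof -
  \<comment> \<open>The conditional between truth values is rewritten as two implications, to which
    the closure rules apply.\<close>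
  have "recursive (\<lambda>p n. of_bool
     ((n = 2 * half n \<longrightarrow> (pfst (half n), psnd (half n)) \<in> kb_rel (source (oracle_tree p))) \<and>
      (n \<noteq> 2 * half n \<longrightarrow> (pfst (half n), psnd (half n)) \<in> kb_rel (target (oracle_tree p)))))"
    by (intro rec_intros decidable_kb_rel decidable_source decidable_target)
  moreover have "comparison_instance = (\<lambda>p n. of_bool
     ((n = 2 * half n \<longrightarrow> (pfst (half n), psnd (half n)) \<in> kb_rel (source (oracle_tree p))) \<and>
      (n \<noteq> 2 * half n \<longrightarrow> (pfst (half n), psnd (half n)) \<in> kb_rel (target (oracle_tree p)))))"
    by (intro ext) (simp add: comparison_instance_def)
  ultimately show ?thesis by simp
qed

lemma left_rel_comparison_instance:
  "left_rel (comparison_instance p) = kb_rel (source (oracle_tree p))"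
proof -
  have "comparison_instance p (2 * prod_encode (a, b)) = 1
      \<longleftrightarrow> (a, b) \<in> kb_rel (source (oracle_tree p))" for a b
    by (simp only: comparison_instance_def half_simps) simp
  then show ?thesis unfolding left_rel_def oracle_rel_def by simp
qed

lemma right_rel_comparison_instance:
  "right_rel (comparison_instance p) = kb_rel (target (oracle_tree p))"
proof -
  have "2 * m + 1 \<noteq> 2 * m" for m :: nat by simp
  then have "comparison_instance p (2 * prod_encode (a, b) + 1) = 1
      \<longleftrightarrow> (a, b) \<in> kb_rel (target (oracle_tree p))" for a b
    by (simp only: comparison_instance_def half_simps) simp
  then show ?thesis unfolding right_rel_def oracle_rel_def by simp
qed

lemma in_rep_UC_Baire:
  "in_rep UC_Baire p = Some T \<Longrightarrow> T = oracle_tree p \<and> is_tree T"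
  by (auto simp: UC_Baire_def tree_rep_def oracle_tree_def split: if_splits)

text \<open>\<open>K\<close> finds \<open>x n\<close> as the only \<open>k\<close> whose marker is
  fixed. The search consults nothing but the comparison map, so the reduction is strong.\<close>

lemma UC_Baire_le_CWO: "UC_Baire \<le>\<^sub>s\<^sub>W CWO"
proof -
  define H :: "(nat \<Rightarrow> nat) \<rightharpoonup> (nat \<Rightarrow> nat)"
    where "H p = Some (comparison_instance p)" for p
  define fixes_marker where "fixes_marker f k n \<longleftrightarrow>
      f (list_encode [prod_encode (n, k), 0]) = list_encode [prod_encode (n, k), 0]"
    for f :: "nat \<Rightarrow> nat" and k n
  define K :: "(nat \<Rightarrow> nat) \<rightharpoonup> (nat \<Rightarrow> nat)" where
    "K f = (if \<forall>n. \<exists>k. fixes_marker f k n then Some (\<lambda>n. LEAST k. fixes_marker f k n) else None)"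
    for f
  have "computable H"
    unfolding H_def by (rule computable_total[OF recursive_comparison_instance])
  moreover have "computable K"
    unfolding K_def
    by (rule computable_search) (simp only: fixes_marker_def list_encode.simps, intro rec_intros)
  moreover have "realizes (K \<circ>\<^sub>m G \<circ>\<^sub>m H) UC_Baire" if G: "realizes G CWO" for G
    unfolding realizes_def
  proof (intro ballI allI impI)
    fix T p assume T: "T \<in> pdom UC_Baire" and p: "in_rep UC_Baire p = Some T"
    obtain x where x: "paths T = {x}" using T by (auto simp: pdom_def UC_Baire_def)
    have tree: "is_tree T" and "T = oracle_tree p" using in_rep_UC_Baire[OF p] by auto
    define z where "z = (kb_rel (source T), kb_rel (target T))"
    have name: "in_rep CWO (comparison_instance p) = Some z"
      unfolding in_rep_CWO left_rel_comparison_instance right_rel_comparison_instance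
      using is_WO_source[OF tree x] is_WO_target[OF tree x] \<open>T = oracle_tree p\<close> by (simp add: z_def)
    have sols: "sols CWO z = {comparison_map z}" by (simp add: CWO_def)
    have "z \<in> ran (in_rep CWO)" using name unfolding ran_def by blast
    with sols have "z \<in> pdom CWO" by (simp add: pdom_def)
    with G name obtain q y where "G (comparison_instance p) = Some q" "out_rep CWO q = Some y"
        "y \<in> {comparison_map z}"
      unfolding realizes_def sols[symmetric] by blast
    then have Gp: "G (comparison_instance p) = Some (comparison_map z)"
      by (simp add: CWO_def baire_rep_def)
    have "fixes_marker (comparison_map z) k n \<longleftrightarrow> x n = k" for k n
      unfolding fixes_marker_def z_def comparison_map_marker[OF tree x] by simp
    moreover have "(LEAST k. x n = k) = x n" for n by (rule Least_equality) auto
    ultimately have "K (comparison_map z) = Some x" by (simp add: K_def)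
    then have "(K \<circ>\<^sub>m G \<circ>\<^sub>m H) p = Some x" by (simp add: map_comp_def H_def Gp)
    then show "\<exists>q y. (K \<circ>\<^sub>m G \<circ>\<^sub>m H) p = Some q \<and> out_rep UC_Baire q = Some y \<and>
        y \<in> sols UC_Baire T"
      using x by (simp add: UC_Baire_def baire_rep_def)
  qed
  ultimately show ?thesis unfolding sW_reducible_def by blast
qed

theorem theorem5p5:
  shows "UC_Baire \<equiv>\<^sub>s\<^sub>W CWO"
  unfolding sW_equivalent_def using UC_Baire_le_CWO CWO_le_UC_Baire by blast

end
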